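(* Let $\mathcal{A}$ be a skeletally small, preabelian category. Let $\xi\colon X\xrightarrow{f}Y\xrightarrow{g}Z$ be a stable exact sequence in $\mathcal{A}$. Then statements (i)–(iii) below are equivalent. (i) $\xi$ is an Auslander-Reiten sequence. (ii) $\operatorname{End}_{\mathcal{A}}(X)$ is a local ring and $g$ is right almost split. (iii) $\operatorname{End}_{\mathcal{A}}(Z)$ is a local ring and $f$ is left almost split. Suppose further that $\mathcal{A}$ is quasi-abelian and Krull-Schmidt. Then statements (i)–(vi) are equivalent, where (iv)–(vi) are: (iv) $f$ is minimal left almost split. (v) $g$ is minimal right almost split. (vi) $f$ and $g$ are irreducible.
   Context: A preabelian category is an additive category in which every morphism has a kernel and a cokernel. A preabelian category is quasi-abelian if every pullback of a cokernel is a cokernel and every pushout of a kernel is a kernel. An additive category is Krull-Schmidt if every object is a finite direct sum $X_1\oplus\cdots\oplus X_n$ of objects whose endomorphism rings are local. A sequence $X\xrightarrow{f}Y\xrightarrow{g}Z$ is short exact if $f=\ker g$ and $g=\operatorname{coker} f$. For a complex $\xi\colon X\xrightarrow{f}Y\xrightarrow{g}Z$ (i.e. $gf=0$) in a preabelian category and $a\colon X\to X'$, the complex $a\xi$ is $X'\xrightarrow{f'}X'\amalg_X Y\xrightarrow{g'}Z$, where $X'\amalg_XY$ is the pushout of $a$ along $f$, with structure maps $f'$ and $a'\colon Y\to X'\amalg_X Y$, and $g'$ is the unique morphism with $g'f'=0$, $g'a'=g$. Dually, for $b\colon Z'\to Z$, the complex $\xi b$ is $X\xrightarrow{f'}Y\prod_Z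 Z'\xrightarrow{g'}Z'$, where $Y\prod_ZZ'$ is the pullback of $g$ along $b$, with structure maps $g'$ and $b'\colon Y\prod_Z Z'\to Y$, and $f'$ is the unique morphism with $g'f'=0$, $b'f'=f$. A short exact sequence $\xi$ is stable exact if $a\xi$ and $\xi b$ are short exact for all $a\colon X\to X'$ and all $b\colon Z'\to Z$. A morphism $f\colon X\to Y$ is right almost split if it is not a retraction and every non-retraction $u\colon U\to Y$ factors as $u=f\hat u$ for some $\hat u\colon U\to X$; it is right minimal if $fg=f$ with $g\colon X\to X$ implies $g$ is an automorphism; it is minimal right almost split if it is both. Left almost split, left minimal and minimal left almost split are defined dually (a left almost split $f\colon X\to Y$ is not a section, and every non-section $u\colon X\to U$ factors as $u=\hat u f$). A morphism $f\colon X\to Y$ is irreducible if it is neither a section nor a retraction, and whenever $f=hg$, either $h$ is a retraction or $g$ is a section. A weak kernel of $f\colon X\to Y$ is a morphism $w\colon W\to X$ with $fw=0$ such that every $g\colon V\to X$ with $fg=0$ factors (not necessarily uniquely) through $w$; weak cokernels are dual. An Auslander-Reiten sequence in an additive category is a sequence $X\xrightarrow{f}Y\xrightarrow{g}Z$ such that $f$ is a weak kernel of $g$, $g$ is a weak cokernel of $f$, $f$ is minimal left almost split, and $g$ is minimal right almost split. *)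

theory Defs
  imports "HOL-Algebra.Ring"
begin

section \<open>Categories\<close>

record ('o, 'm) category =
  obj :: "'o set"
  arr :: "'m set"
  src :: "'m \<Rightarrow> 'o"
  tgt :: "'m \<Rightarrow> 'o"
  ident :: "'o \<Rightarrow> 'm"
  comp_arr :: "'m \<Rightarrow> 'm \<Rightarrow> 'm" (infixl "\<cdot>\<index>" 75)

definition Hom :: "('o, 'm, 'z) category_scheme \<Rightarrow> 'o \<Rightarrow> 'o \<Rightarrow> 'm set" where
  "Hom C X Y = {f \<in> arr C. src C f = X \<and> tgt C f = Y}"

text \<open>Composition is in applicative order: \<open>g \<cdot> f\<close> is first \<open>f\<close>, then \<open>g\<close>. The values
  of the operations outside the objects and the composable arrows are irrelevant.\<close>

locale category =
  fixes C :: "('o, 'm, 'z) category_scheme" (structure)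
  assumes src_obj: "f \<in> arr C \<Longrightarrow> src C f \<in> obj C"
    and tgt_obj: "f \<in> arr C \<Longrightarrow> tgt C f \<in> obj C"
    and ident_hom: "X \<in> obj C \<Longrightarrow> ident C X \<in> Hom C X X"
    and comp_hom: "\<lbrakk>f \<in> Hom C X Y; g \<in> Hom C Y Z\<rbrakk> \<Longrightarrow> g \<cdot> f \<in> Hom C X Z"
    and comp_assoc: "\<lbrakk>f \<in> Hom C W X; g \<in> Hom C X Y; h \<in> Hom C Y Z\<rbrakk>
      \<Longrightarrow> h \<cdot> g \<cdot> f = h \<cdot> (g \<cdot> f)"
    and ident_comp: "f \<in> Hom C X Y \<Longrightarrow> ident C Y \<cdot> f = f"
    and comp_ident: "f \<in> Hom C X Y \<Longrightarrow> f \<cdot> ident C X = f"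

definition section_arr :: "('o, 'm, 'z) category_scheme \<Rightarrow> 'm \<Rightarrow> bool" where
  "section_arr C f \<longleftrightarrow> f \<in> arr C \<and>
    (\<exists>r \<in> Hom C (tgt C f) (src C f). r \<cdot>\<^bsub>C\<^esub> f = ident C (src C f))"

definition retraction_arr :: "('o, 'm, 'z) category_scheme \<Rightarrow> 'm \<Rightarrow> bool" where
  "retraction_arr C f \<longleftrightarrow> f \<in> arr C \<and>
    (\<exists>s \<in> Hom C (tgt C f) (src C f). f \<cdot>\<^bsub>C\<^esub> s = ident C (tgt C f))"

definition iso_arr :: "('o, 'm, 'z) category_scheme \<Rightarrow> 'm \<Rightarrow> bool" where
  "iso_arr C f \<longleftrightarrow> f \<in> arr C \<and>
    (\<exists>g \<in> Hom C (tgt C f) (src C f).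
      g \<cdot>\<^bsub>C\<^esub> f = ident C (src C f) \<and> f \<cdot>\<^bsub>C\<^esub> g = ident C (tgt C f))"

text \<open>The isomorphism classes of objects have a set of representatives. As the objects of a
  \<^const>\<open>category\<close> form a HOL set, this holds for every category considered here (take all
  objects); it is stated in order to record the size condition.\<close>

definition skeletally_small :: "('o, 'm, 'z) category_scheme \<Rightarrow> bool" where
  "skeletally_small C \<longleftrightarrow>
    (\<exists>S \<subseteq> obj C. \<forall>X \<in> obj C. \<exists>Y \<in> S. \<exists>f \<in> Hom C X Y. iso_arr C f)"

definition is_pushout ::
  "('o, 'm, 'z) category_scheme \<Rightarrow> 'm \<Rightarrow> 'm \<Rightarrow> 'm \<Rightarrow> 'm \<Rightarrow> bool"
  \<comment> \<open>\<open>f' : X' \<rightarrow> P\<close> and \<open>a' : Y \<rightarrow> P\<close> form a pushout of \<open>a : X \<rightarrow> X'\<close> and \<open>f : X \<rightarrow> Y\<close>\<close> where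
  "is_pushout C a f f' a' \<longleftrightarrow>
    a \<in> arr C \<and> f \<in> arr C \<and> f' \<in> arr C \<and> a' \<in> arr C \<and>
    src C a = src C f \<and> src C f' = tgt C a \<and> src C a' = tgt C f \<and> tgt C f' = tgt C a' \<and>
    f' \<cdot>\<^bsub>C\<^esub> a = a' \<cdot>\<^bsub>C\<^esub> f \<and>
    (\<forall>W. \<forall>p \<in> Hom C (tgt C a) W. \<forall>q \<in> Hom C (tgt C f) W.
      p \<cdot>\<^bsub>C\<^esub> a = q \<cdot>\<^bsub>C\<^esub> f \<longrightarrow>
      (\<exists>!u. u \<in> Hom C (tgt C f') W \<and> u \<cdot>\<^bsub>C\<^esub> f' = p \<and> u \<cdot>\<^bsub>C\<^esub> a' = q))"

definition is_pullback ::
  "('o, 'm, 'z) category_scheme \<Rightarrow> 'm \<Rightarrow> 'm \<Rightarrow> 'm \<Rightarrow> 'm \<Rightarrow> bool"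
  \<comment> \<open>\<open>g' : P \<rightarrow> Z'\<close> and \<open>b' : P \<rightarrow> Y\<close> form a pullback of \<open>b : Z' \<rightarrow> Z\<close> and \<open>g : Y \<rightarrow> Z\<close>\<close> where
  "is_pullback C b g g' b' \<longleftrightarrow>
    b \<in> arr C \<and> g \<in> arr C \<and> g' \<in> arr C \<and> b' \<in> arr C \<and>
    tgt C b = tgt C g \<and> tgt C g' = src C b \<and> tgt C b' = src C g \<and> src C g' = src C b' \<and>
    b \<cdot>\<^bsub>C\<^esub> g' = g \<cdot>\<^bsub>C\<^esub> b' \<and>
    (\<forall>W. \<forall>p \<in> Hom C W (src C b). \<forall>q \<in> Hom C W (src C g).
      b \<cdot>\<^bsub>C\<^esub> p = g \<cdot>\<^bsub>C\<^esub> q \<longrightarrow>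
      (\<exists>!u. u \<in> Hom C W (src C g') \<and> g' \<cdot>\<^bsub>C\<^esub> u = p \<and> b' \<cdot>\<^bsub>C\<^esub> u = q))"


section \<open>Almost split and irreducible morphisms\<close>

definition right_almost_split :: "('o, 'm, 'z) category_scheme \<Rightarrow> 'm \<Rightarrow> bool" where
  "right_almost_split C f \<longleftrightarrow> f \<in> arr C \<and> \<not> retraction_arr C f \<and>
    (\<forall>U. \<forall>u \<in> Hom C U (tgt C f). \<not> retraction_arr C u \<longrightarrow>
      (\<exists>v \<in> Hom C U (src C f). u = f \<cdot>\<^bsub>C\<^esub> v))"

definition left_almost_split :: "('o, 'm, 'z) category_scheme \<Rightarrow> 'm \<Rightarrow> bool" where
  "left_almost_split C f \<longleftrightarrow> f \<in> arr C \<and> \<not> section_arr C f \<and>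
    (\<forall>U. \<forall>u \<in> Hom C (src C f) U. \<not> section_arr C u \<longrightarrow>
      (\<exists>v \<in> Hom C (tgt C f) U. u = v \<cdot>\<^bsub>C\<^esub> f))"

definition right_minimal :: "('o, 'm, 'z) category_scheme \<Rightarrow> 'm \<Rightarrow> bool" where
  "right_minimal C f \<longleftrightarrow> f \<in> arr C \<and>
    (\<forall>g \<in> Hom C (src C f) (src C f). f \<cdot>\<^bsub>C\<^esub> g = f \<longrightarrow> iso_arr C g)"

definition left_minimal :: "('o, 'm, 'z) category_scheme \<Rightarrow> 'm \<Rightarrow> bool" where
  "left_minimal C f \<longleftrightarrow> f \<in> arr C \<and>
    (\<forall>g \<in> Hom C (tgt C f) (tgt C f). g \<cdot>\<^bsub>C\<^esub> f = f \<longrightarrow> iso_arr C g)"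

definition minimal_right_almost_split :: "('o, 'm, 'z) category_scheme \<Rightarrow> 'm \<Rightarrow> bool" where
  "minimal_right_almost_split C f \<longleftrightarrow> right_almost_split C f \<and> right_minimal C f"

definition minimal_left_almost_split :: "('o, 'm, 'z) category_scheme \<Rightarrow> 'm \<Rightarrow> bool" where
  "minimal_left_almost_split C f \<longleftrightarrow> left_almost_split C f \<and> left_minimal C f"

definition irreducible_arr :: "('o, 'm, 'z) category_scheme \<Rightarrow> 'm \<Rightarrow> bool" where
  "irreducible_arr C f \<longleftrightarrow> f \<in> arr C \<and> \<not> section_arr C f \<and> \<not> retraction_arr C f \<and>
    (\<forall>W. \<forall>g \<in> Hom C (src C f) W. \<forall>h \<in> Hom C W (tgt C f).
      f = h \<cdot>\<^bsub>C\<^esub> g \<longrightarrow> retraction_arr C h \<or> section_arr C g)"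


section \<open>Additive categories\<close>

record ('o, 'm) preadditive_category = "('o, 'm) category" +
  zero_arr :: "'o \<Rightarrow> 'o \<Rightarrow> 'm"
  add_arr :: "'m \<Rightarrow> 'm \<Rightarrow> 'm"

definition hom_group ::
  "('o, 'm, 'z) preadditive_category_scheme \<Rightarrow> 'o \<Rightarrow> 'o \<Rightarrow> 'm monoid" where
  "hom_group C X Y = \<lparr>carrier = Hom C X Y, monoid.mult = add_arr C, one = zero_arr C X Y\<rparr>"

definition end_ring :: "('o, 'm, 'z) preadditive_category_scheme \<Rightarrow> 'o \<Rightarrow> 'm ring" where
  "end_ring C X = \<lparr>carrier = Hom C X X, monoid.mult = comp_arr C, one = ident C X,
    zero = zero_arr C X X, add = add_arr C\<rparr>"

locale preadditive_category = category C
  for C :: "('o, 'm, 'z) preadditive_category_scheme" (structure) +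
  assumes hom_comm_group: "\<lbrakk>X \<in> obj C; Y \<in> obj C\<rbrakk> \<Longrightarrow> comm_group (hom_group C X Y)"
    and comp_add_right: "\<lbrakk>f \<in> Hom C X Y; g \<in> Hom C X Y; h \<in> Hom C Y Z\<rbrakk>
      \<Longrightarrow> h \<cdot> add_arr C f g = add_arr C (h \<cdot> f) (h \<cdot> g)"
    and comp_add_left: "\<lbrakk>f \<in> Hom C X Y; g \<in> Hom C Y Z; h \<in> Hom C Y Z\<rbrakk>
      \<Longrightarrow> add_arr C g h \<cdot> f = add_arr C (g \<cdot> f) (h \<cdot> f)"

text \<open>\<open>S\<close> is the direct sum (biproduct) of \<open>A 0, \<dots>, A (n - 1)\<close>, with injections \<open>i k\<close> and
  projections \<open>p k\<close>. For \<open>n = 0\<close> this says that \<open>S\<close> is a zero object.\<close>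

definition is_direct_sum :: "('o, 'm, 'z) preadditive_category_scheme \<Rightarrow>
    nat \<Rightarrow> (nat \<Rightarrow> 'o) \<Rightarrow> 'o \<Rightarrow> (nat \<Rightarrow> 'm) \<Rightarrow> (nat \<Rightarrow> 'm) \<Rightarrow> bool" where
  "is_direct_sum C n A S i p \<longleftrightarrow> S \<in> obj C \<and>
    (\<forall>k<n. i k \<in> Hom C (A k) S \<and> p k \<in> Hom C S (A k)) \<and>
    (\<forall>j<n. \<forall>k<n. p j \<cdot>\<^bsub>C\<^esub> i k = (if j = k then ident C (A k) else zero_arr C (A k) (A j))) \<and>
    (\<Oplus>\<^bsub>end_ring C S\<^esub>k \<in> {..<n}. i k \<cdot>\<^bsub>C\<^esub> p k) = ident C S"

locale additive_category = preadditive_category +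
  assumes has_direct_sums:
    "(\<And>k. k < n \<Longrightarrow> A k \<in> obj C) \<Longrightarrow> \<exists>S i p. is_direct_sum C n A S i p"

text \<open>A (not necessarily commutative) ring is local if it is nonzero and the sum of any two
  non-units is a non-unit.\<close>

definition local_ring :: "('a, 'z) ring_scheme \<Rightarrow> bool" where
  "local_ring R \<longleftrightarrow> ring R \<and> \<one>\<^bsub>R\<^esub> \<noteq> \<zero>\<^bsub>R\<^esub> \<and>
    (\<forall>a \<in> carrier R - Units R. \<forall>b \<in> carrier R - Units R. a \<oplus>\<^bsub>R\<^esub> b \<notin> Units R)"

locale krull_schmidt_category = additive_category +
  assumes local_decomposition: "X \<in> obj C \<Longrightarrow>
    \<exists>n A i p. (\<forall>k<n. A k \<in> obj C \<and> local_ring (end_ring C (A k))) \<and> is_direct_sum C n A X i p"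


section \<open>Preabelian and quasi-abelian categories\<close>

definition is_kernel ::
  "('o, 'm, 'z) preadditive_category_scheme \<Rightarrow> 'm \<Rightarrow> 'm \<Rightarrow> bool"
  \<comment> \<open>\<open>k\<close> is a kernel of \<open>f\<close>\<close> where
  "is_kernel C k f \<longleftrightarrow> k \<in> arr C \<and> f \<in> arr C \<and> tgt C k = src C f \<and>
    f \<cdot>\<^bsub>C\<^esub> k = zero_arr C (src C k) (tgt C f) \<and>
    (\<forall>V. \<forall>g \<in> Hom C V (src C f). f \<cdot>\<^bsub>C\<^esub> g = zero_arr C V (tgt C f) \<longrightarrow>
      (\<exists>!u. u \<in> Hom C V (src C k) \<and> g = k \<cdot>\<^bsub>C\<^esub> u))"

definition is_cokernel ::
  "('o, 'm, 'z) preadditive_category_scheme \<Rightarrow> 'm \<Rightarrow> 'm \<Rightarrow> bool"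
  \<comment> \<open>\<open>c\<close> is a cokernel of \<open>f\<close>\<close> where
  "is_cokernel C c f \<longleftrightarrow> c \<in> arr C \<and> f \<in> arr C \<and> src C c = tgt C f \<and>
    c \<cdot>\<^bsub>C\<^esub> f = zero_arr C (src C f) (tgt C c) \<and>
    (\<forall>V. \<forall>g \<in> Hom C (tgt C f) V. g \<cdot>\<^bsub>C\<^esub> f = zero_arr C (src C f) V \<longrightarrow>
      (\<exists>!u. u \<in> Hom C (tgt C c) V \<and> g = u \<cdot>\<^bsub>C\<^esub> c))"

definition weak_kernel ::
  "('o, 'm, 'z) preadditive_category_scheme \<Rightarrow> 'm \<Rightarrow> 'm \<Rightarrow> bool"
  \<comment> \<open>\<open>w\<close> is a weak kernel of \<open>f\<close>\<close> where
  "weak_kernel C w f \<longleftrightarrow> w \<in> arr C \<and> f \<in> arr C \<and> tgt C w = src C f \<and>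
    f \<cdot>\<^bsub>C\<^esub> w = zero_arr C (src C w) (tgt C f) \<and>
    (\<forall>V. \<forall>g \<in> Hom C V (src C f). f \<cdot>\<^bsub>C\<^esub> g = zero_arr C V (tgt C f) \<longrightarrow>
      (\<exists>u \<in> Hom C V (src C w). g = w \<cdot>\<^bsub>C\<^esub> u))"

definition weak_cokernel ::
  "('o, 'm, 'z) preadditive_category_scheme \<Rightarrow> 'm \<Rightarrow> 'm \<Rightarrow> bool"
  \<comment> \<open>\<open>w\<close> is a weak cokernel of \<open>f\<close>\<close> where
  "weak_cokernel C w f \<longleftrightarrow> w \<in> arr C \<and> f \<in> arr C \<and> src C w = tgt C f \<and>
    w \<cdot>\<^bsub>C\<^esub> f = zero_arr C (src C f) (tgt C w) \<and>
    (\<forall>V. \<forall>g \<in> Hom C (tgt C f) V. g \<cdot>\<^bsub>C\<^esub> f = zero_arr C (src C f) V \<longrightarrow>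
      (\<exists>u \<in> Hom C (tgt C w) V. g = u \<cdot>\<^bsub>C\<^esub> w))"

locale preabelian_category = additive_category +
  assumes has_kernel: "f \<in> arr C \<Longrightarrow> \<exists>k. is_kernel C k f"
    and has_cokernel: "f \<in> arr C \<Longrightarrow> \<exists>c. is_cokernel C c f"

locale quasi_abelian_category = preabelian_category +
  assumes pullback_cokernel:
    "\<lbrakk>is_cokernel C g h; is_pullback C b g g' b'\<rbrakk> \<Longrightarrow> \<exists>h'. is_cokernel C g' h'"
    and pushout_kernel:
    "\<lbrakk>is_kernel C f h; is_pushout C a f f' a'\<rbrakk> \<Longrightarrow> \<exists>h'. is_kernel C f' h'"


section \<open>Stable exact and Auslander-Reiten sequences\<close>

definition short_exact ::
  "('o, 'm, 'z) preadditive_category_scheme \<Rightarrow> 'm \<Rightarrow> 'm \<Rightarrow> bool" where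
  "short_exact C f g \<longleftrightarrow> is_kernel C f g \<and> is_cokernel C g f"

text \<open>Pushouts and pullbacks are determined only up to isomorphism; the following relations
  hold between a complex and all the choices of \<open>a\<xi>\<close> and \<open>\<xi>b\<close>.\<close>

definition pushout_complex ::
  "('o, 'm, 'z) preadditive_category_scheme \<Rightarrow> 'm \<Rightarrow> 'm \<Rightarrow> 'm \<Rightarrow> 'm \<Rightarrow> 'm \<Rightarrow> bool" where
  "pushout_complex C a f g f' g' \<longleftrightarrow>
    (\<exists>a'. is_pushout C a f f' a' \<and> g' \<in> Hom C (tgt C f') (tgt C g) \<and>
      g' \<cdot>\<^bsub>C\<^esub> f' = zero_arr C (src C f') (tgt C g) \<and> g' \<cdot>\<^bsub>C\<^esub> a' = g)"

definition pullback_complex ::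
  "('o, 'm, 'z) preadditive_category_scheme \<Rightarrow> 'm \<Rightarrow> 'm \<Rightarrow> 'm \<Rightarrow> 'm \<Rightarrow> 'm \<Rightarrow> bool" where
  "pullback_complex C b f g f' g' \<longleftrightarrow>
    (\<exists>b'. is_pullback C b g g' b' \<and> f' \<in> Hom C (src C f) (src C g') \<and>
      g' \<cdot>\<^bsub>C\<^esub> f' = zero_arr C (src C f) (tgt C g') \<and> b' \<cdot>\<^bsub>C\<^esub> f' = f)"

definition stable_exact ::
  "('o, 'm, 'z) preadditive_category_scheme \<Rightarrow> 'm \<Rightarrow> 'm \<Rightarrow> bool" where
  "stable_exact C f g \<longleftrightarrow> short_exact C f g \<and>
    (\<forall>a f' g'. pushout_complex C a f g f' g' \<longrightarrow> short_exact C f' g') \<and>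
    (\<forall>b f' g'. pullback_complex C b f g f' g' \<longrightarrow> short_exact C f' g')"

definition auslander_reiten_sequence ::
  "('o, 'm, 'z) preadditive_category_scheme \<Rightarrow> 'm \<Rightarrow> 'm \<Rightarrow> bool" where
  "auslander_reiten_sequence C f g \<longleftrightarrow> weak_kernel C f g \<and> weak_cokernel C g f \<and>
    minimal_left_almost_split C f \<and> minimal_right_almost_split C g"

end

theory Submission
  imports Defs
begin

text \<open>
  Every self-dual notion is transported along the opposite category, so that each half of the
  argument below is carried out once.

  If \<open>f\<close> is left almost split, then a sum of two non-sections \<open>v f\<close> and \<open>w f\<close> in \<open>End X\<close> is
  \<open>(v + w) f\<close>, again a non-section; a ring whose elements without left inverse are closed under
  addition is local. Dually \<open>End Z\<close> is local when \<open>g\<close> is right almost split. Minimality then comes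
  for free: \<open>g h = g\<close> forces \<open>h = 1 + f t\<close> because \<open>f\<close> is a kernel of \<open>g\<close>; the element \<open>1 + t f\<close> of
  the local ring \<open>End X\<close> is invertible since \<open>f\<close> is not a section, and \<open>1 + f t\<close> is invertible
  whenever \<open>1 + t f\<close> is (\<open>right_minimal_of_kernel\<close>). What remains of the first equivalence is that
  \<open>f\<close> is left almost split when \<open>End X\<close> is local and \<open>g\<close> is right almost split. For a non-section
  \<open>u\<close> starting in \<open>X\<close>, form the pushout sequence along \<open>u\<close>. If it splits, \<open>u\<close> factors through
  \<open>f\<close>. If it does not split, its second arrow factors through \<open>g\<close>, and comparing the two
  sequences produces \<open>w\<close> with \<open>w u = 1 + t f\<close>, which is invertible, so that \<open>u\<close> would be a section
  (\<open>left_almost_split_of_right_almost_split\<close>).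

  In the Krull-Schmidt case everything passes through irreducibility. Pulling the sequence back along
  \<open>u : U \<rightarrow> Z\<close> factors an irreducible \<open>f\<close> through the pullback, so either \<open>u\<close> factors through \<open>g\<close> or
  \<open>g\<close> factors through \<open>u\<close> (\<open>irreducible_dichotomy\<close>). The inclusions of the local summands of \<open>Z\<close>
  cannot all factor through \<open>g\<close>, since otherwise the sequence splits; hence \<open>g\<close> factors through the
  inclusion of a single local summand, and as \<open>g\<close> is epi this summand is all of \<open>Z\<close>
  (\<open>irreducible_kernel_local_ring_end\<close>). A minimal left almost split \<open>f\<close> is irreducible, so \<open>End Z\<close>
  is local and the first part applies. If \<open>f\<close> and \<open>g\<close> are both irreducible, the dichotomy for \<open>f\<close>,
  tested on objects with local endomorphism ring, together with irreducibility of \<open>g\<close> shows that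
  \<open>g\<close> is right almost split.
\<close>

section \<open>The opposite category\<close>

definition opposite ::
  "('o, 'm, 'z) preadditive_category_scheme \<Rightarrow> ('o, 'm, 'z) preadditive_category_scheme" where
  "opposite C = C\<lparr>src := tgt C, tgt := src C, comp_arr := (\<lambda>g f. f \<cdot>\<^bsub>C\<^esub> g),
    zero_arr := (\<lambda>X Y. zero_arr C Y X)\<rparr>"

lemma opposite_simps [simp]:
  "obj (opposite C) = obj C" "arr (opposite C) = arr C"
  "src (opposite C) = tgt C" "tgt (opposite C) = src C" "ident (opposite C) = ident C"
  "g \<cdot>\<^bsub>opposite C\<^esub> f = f \<cdot>\<^bsub>C\<^esub> g"
  "zero_arr (opposite C) X Y = zero_arr C Y X" "add_arr (opposite C) = add_arr C"
  by (simp_all add: opposite_def)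

lemma Hom_opposite [simp]: "Hom (opposite C) X Y = Hom C Y X"
  by (auto simp: Hom_def)

lemma section_arr_opposite [simp]: "section_arr (opposite C) f \<longleftrightarrow> retraction_arr C f"
  by (simp add: section_arr_def retraction_arr_def)

lemma retraction_arr_opposite [simp]: "retraction_arr (opposite C) f \<longleftrightarrow> section_arr C f"
  by (simp add: section_arr_def retraction_arr_def)

lemma iso_arr_opposite [simp]: "iso_arr (opposite C) f \<longleftrightarrow> iso_arr C f"
  by (auto simp: iso_arr_def)

lemma almost_split_opposite [simp]:
  "left_almost_split (opposite C) f \<longleftrightarrow> right_almost_split C f"
  "right_almost_split (opposite C) f \<longleftrightarrow> left_almost_split C f"
  "left_minimal (opposite C) f \<longleftrightarrow> right_minimal C f"
  "right_minimal (opposite C) f \<longleftrightarrow> left_minimal C f"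
  by (simp_all add: left_almost_split_def right_almost_split_def
      left_minimal_def right_minimal_def)

lemma minimal_almost_split_opposite [simp]:
  "minimal_left_almost_split (opposite C) f \<longleftrightarrow> minimal_right_almost_split C f"
  "minimal_right_almost_split (opposite C) f \<longleftrightarrow> minimal_left_almost_split C f"
  by (simp_all add: minimal_left_almost_split_def minimal_right_almost_split_def)

lemma irreducible_arr_opposite [simp]: "irreducible_arr (opposite C) f \<longleftrightarrow> irreducible_arr C f"
  unfolding irreducible_arr_def by auto

lemma is_kernel_opposite [simp]:
  "is_kernel (opposite C) k f \<longleftrightarrow> is_cokernel C k f"
  "is_cokernel (opposite C) k f \<longleftrightarrow> is_kernel C k f"
  by (auto simp: is_kernel_def is_cokernel_def)

lemma short_exact_opposite [simp]: "short_exact (opposite C) g f \<longleftrightarrow> short_exact C f g"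
  by (auto simp: short_exact_def)

lemma is_pushout_opposite [simp]:
  "is_pushout (opposite C) a f f' a' \<longleftrightarrow> is_pullback C a f f' a'"
  "is_pullback (opposite C) a f f' a' \<longleftrightarrow> is_pushout C a f f' a'"
  by (simp_all add: is_pushout_def is_pullback_def)

lemma pushout_complex_opposite [simp]:
  "pushout_complex (opposite C) a g f g' f' \<longleftrightarrow> pullback_complex C a f g f' g'"
  "pullback_complex (opposite C) a g f g' f' \<longleftrightarrow> pushout_complex C a f g f' g'"
  by (simp_all add: pushout_complex_def pullback_complex_def)

lemma stable_exact_opposite [simp]: "stable_exact (opposite C) g f \<longleftrightarrow> stable_exact C f g"
  by (auto simp: stable_exact_def)

lemma weak_kernel_opposite [simp]:
  "weak_kernel (opposite C) k f \<longleftrightarrow> weak_cokernel C k f"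
  "weak_cokernel (opposite C) k f \<longleftrightarrow> weak_kernel C k f"
  by (simp_all add: weak_kernel_def weak_cokernel_def)

lemma auslander_reiten_sequence_opposite [simp]:
  "auslander_reiten_sequence (opposite C) g f \<longleftrightarrow> auslander_reiten_sequence C f g"
  by (auto simp: auslander_reiten_sequence_def)

lemma is_direct_sum_opposite [simp]:
  "is_direct_sum (opposite C) n A S p i \<longleftrightarrow> is_direct_sum C n A S i p"
proof -
  have "finsum (end_ring (opposite C) S) F N = finsum (end_ring C S) F N"
    for F and N :: "nat set"
    by (simp add: finsum_def end_ring_def)
  then show ?thesis
    by (auto simp: is_direct_sum_def)
qed

lemma hom_group_opposite [simp]: "hom_group (opposite C) X Y = hom_group C Y X"
  by (simp add: hom_group_def)

section \<open>Sections, retractions and irreducible arrows\<close>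

context category
begin

text \<open>Stated with \<^const>\<open>src\<close> and \<^const>\<open>tgt\<close> instead of \<^const>\<open>Hom\<close>, the laws have no
  variables that occur only in their premises; conditional rewriting can then discharge the premises
  for composites.\<close>

lemma comp_arr_simps [simp]:
  assumes "f \<in> arr C" "g \<in> arr C" "tgt C f = src C g"
  shows "g \<cdot> f \<in> arr C" "src C (g \<cdot> f) = src C f" "tgt C (g \<cdot> f) = tgt C g"
  using comp_hom[of f "src C f" "tgt C f" g "tgt C g"] assms by (auto simp: Hom_def)

lemma arr_assoc [simp]:
  assumes "f \<in> arr C" "g \<in> arr C" "h \<in> arr C" "tgt C f = src C g" "tgt C g = src C h"
  shows "h \<cdot> g \<cdot> f = h \<cdot> (g \<cdot> f)"
  using comp_assoc[of f _ _ g _ h] assms by (auto simp: Hom_def)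

lemma ident_simps [simp]:
  assumes "X \<in> obj C"
  shows "ident C X \<in> arr C" "src C (ident C X) = X" "tgt C (ident C X) = X"
  using ident_hom[OF assms] by (auto simp: Hom_def)

lemma arr_ident_simps [simp]:
  "\<lbrakk>f \<in> arr C; tgt C f = Y\<rbrakk> \<Longrightarrow> ident C Y \<cdot> f = f"
  "\<lbrakk>f \<in> arr C; src C f = X\<rbrakk> \<Longrightarrow> f \<cdot> ident C X = f"
  using ident_comp[of f] comp_ident[of f] by (auto simp: Hom_def)

lemma Hom_obj:
  assumes "f \<in> Hom C X Y"
  shows "X \<in> obj C" "Y \<in> obj C"
  using assms src_obj tgt_obj by (auto simp: Hom_def)


lemma section_arr_iff:
  "f \<in> Hom C X Y \<Longrightarrow> section_arr C f \<longleftrightarrow> (\<exists>r \<in> Hom C Y X. r \<cdot> f = ident C X)"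
  by (auto simp: section_arr_def Hom_def)

lemma retraction_arr_iff:
  "f \<in> Hom C X Y \<Longrightarrow> retraction_arr C f \<longleftrightarrow> (\<exists>s \<in> Hom C Y X. f \<cdot> s = ident C Y)"
  by (auto simp: retraction_arr_def Hom_def)

lemma iso_arr_iff:
  "f \<in> Hom C X Y \<Longrightarrow>
    iso_arr C f \<longleftrightarrow> (\<exists>g \<in> Hom C Y X. g \<cdot> f = ident C X \<and> f \<cdot> g = ident C Y)"
  by (auto simp: iso_arr_def Hom_def)

lemma left_almost_splitD:
  assumes "left_almost_split C f" "f \<in> Hom C X Y" "u \<in> Hom C X U" "\<not> section_arr C u"
  obtains v where "v \<in> Hom C Y U" "u = v \<cdot> f"
  using assms by (auto simp: left_almost_split_def Hom_def)

lemma right_almost_splitD: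
  assumes "right_almost_split C f" "f \<in> Hom C X Y" "u \<in> Hom C U Y" "\<not> retraction_arr C u"
  obtains v where "v \<in> Hom C U X" "u = f \<cdot> v"
  using assms by (auto simp: right_almost_split_def Hom_def)

lemma irreducible_arrD:
  assumes "irreducible_arr C f" "f = h \<cdot> k" "f \<in> Hom C X Y" "k \<in> Hom C X W" "h \<in> Hom C W Y"
  shows "retraction_arr C h \<or> section_arr C k"
proof -
  have "src C f = X" "tgt C f = Y" using assms(3) by (auto simp: Hom_def)
  then show ?thesis using assms unfolding irreducible_arr_def by blast
qed

lemma iso_arr_section: "iso_arr C f \<Longrightarrow> section_arr C f"
  by (auto simp: iso_arr_def section_arr_def)

lemma section_arr_of_comp:
  assumes "f \<in> Hom C X Y" "g \<in> Hom C Y Z" "section_arr C (g \<cdot> f)"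
  shows "section_arr C f"
proof -
  obtain r where "r \<in> Hom C Z X" "r \<cdot> (g \<cdot> f) = ident C X"
    using assms section_arr_iff[OF comp_hom] by blast
  then have "r \<cdot> g \<in> Hom C Y X" "(r \<cdot> g) \<cdot> f = ident C X"
    using assms by (auto simp: Hom_def)
  then show ?thesis
    using section_arr_iff[OF assms(1)] by blast
qed

lemma retraction_of_comp:
  assumes "f \<in> Hom C X Y" "g \<in> Hom C Y Z" "retraction_arr C (g \<cdot> f)"
  shows "retraction_arr C g"
proof -
  obtain s where s: "s \<in> Hom C Z X" "(g \<cdot> f) \<cdot> s = ident C Z"
    using assms retraction_arr_iff[OF comp_hom] by blast
  then have "f \<cdot> s \<in> Hom C Z Y" "g \<cdot> (f \<cdot> s) = ident C Z"
    using assms by (auto simp: Hom_def)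
  then show ?thesis
    using retraction_arr_iff[OF assms(2)] by blast
qed

text \<open>If \<open>f = h k\<close> with \<open>k\<close> not a section, then \<open>k = v f\<close>, so \<open>(h v) f = f\<close> and left minimality
  makes \<open>h v\<close> an automorphism.\<close>

lemma minimal_left_almost_split_irreducible:
  assumes "minimal_left_almost_split C f" "\<not> retraction_arr C f"
  shows "irreducible_arr C f"
  unfolding irreducible_arr_def
proof (intro conjI allI ballI impI)
  from assms have f: "left_almost_split C f" "left_minimal C f" "f \<in> arr C"
    by (auto simp: minimal_left_almost_split_def left_minimal_def)
  then show "f \<in> arr C" "\<not> section_arr C f" "\<not> retraction_arr C f"
    using assms by (auto simp: left_almost_split_def)
  fix W k h
  assume k: "k \<in> Hom C (src C f) W" and h: "h \<in> Hom C W (tgt C f)" and fhk: "f = h \<cdot> k"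
  show "retraction_arr C h \<or> section_arr C k"
  proof (rule disjCI)
    assume "\<not> section_arr C k"
    then obtain v where v: "v \<in> Hom C (tgt C f) W" "k = v \<cdot> f"
      using left_almost_splitD[OF f(1) _ k] f(3) unfolding Hom_def by blast
    have "(h \<cdot> v) \<cdot> f = h \<cdot> (v \<cdot> f)"
      using v(1) h f(3) by (auto simp: Hom_def)
    then have "(h \<cdot> v) \<cdot> f = f"
      using v(2) fhk by metis
    moreover have hv: "h \<cdot> v \<in> Hom C (tgt C f) (tgt C f)"
      using v(1) h by (auto simp: Hom_def)
    ultimately have "iso_arr C (h \<cdot> v)"
      using f(2) by (auto simp: left_minimal_def)
    then obtain w where w: "w \<in> Hom C (tgt C f) (tgt C f)" "(h \<cdot> v) \<cdot> w = ident C (tgt C f)"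
      using iso_arr_iff[OF hv] by blast
    then have "v \<cdot> w \<in> Hom C (tgt C f) W" "h \<cdot> (v \<cdot> w) = ident C (tgt C f)"
      using v(1) h by (auto simp: Hom_def)
    then show "retraction_arr C h"
      using retraction_arr_iff[OF h] by blast
  qed
qed

end

lemma opposite_preadditive_category:
  assumes "preadditive_category C"
  shows "preadditive_category (opposite C)"
proof -
  interpret preadditive_category C by (fact assms)
  show ?thesis
  proof (intro preadditive_category.intro category.intro preadditive_category_axioms.intro)
    fix f W X g Y h Z
    assume "f \<in> Hom (opposite C) W X" "g \<in> Hom (opposite C) X Y" "h \<in> Hom (opposite C) Y Z"
    then show "h \<cdot>\<^bsub>opposite C\<^esub> g \<cdot>\<^bsub>opposite C\<^esub> f = h \<cdot>\<^bsub>opposite C\<^esub> (g \<cdot>\<^bsub>opposite C\<^esub> f)"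
      by (auto simp: Hom_def)
  qed (auto intro: src_obj tgt_obj ident_hom comp_hom ident_comp comp_ident hom_comm_group
      comp_add_left comp_add_right)
qed

lemma opposite_additive_category:
  assumes "additive_category C"
  shows "additive_category (opposite C)"
proof -
  interpret additive_category C by (fact assms)
  interpret op: preadditive_category "opposite C"
    by (rule opposite_preadditive_category) (rule preadditive_category_axioms)
  show ?thesis
  proof
    fix n :: nat and A :: "nat \<Rightarrow> 'a"
    assume "\<And>k. k < n \<Longrightarrow> A k \<in> obj (opposite C)"
    then obtain S i p where "is_direct_sum C n A S i p"
      using has_direct_sums by fastforce
    then show "\<exists>S i p. is_direct_sum (opposite C) n A S i p"
      by (metis is_direct_sum_opposite)
  qed
qed

lemma opposite_preabelian_category:
  assumes "preabelian_category C"
  shows "preabelian_category (opposite C)"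
proof -
  interpret preabelian_category C by (fact assms)
  interpret op: additive_category "opposite C"
    by (rule opposite_additive_category) (rule additive_category_axioms)
  show ?thesis
    by standard (simp_all add: has_kernel has_cokernel)
qed

section \<open>Preadditive categories\<close>

context preadditive_category
begin

abbreviation plus_arr :: "'m \<Rightarrow> 'm \<Rightarrow> 'm" (infixl "\<^bold>+" 65) where
  "f \<^bold>+ g \<equiv> add_arr C f g"

definition neg :: "'m \<Rightarrow> 'm" where
  "neg f = m_inv (hom_group C (src C f) (tgt C f)) f"

lemma zero_hom: "\<lbrakk>X \<in> obj C; Y \<in> obj C\<rbrakk> \<Longrightarrow> zero_arr C X Y \<in> Hom C X Y"
  using monoid.one_closed[OF group.is_monoid[OF comm_group.axioms(2)[OF hom_comm_group]]]
  by (simp add: hom_group_def)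

lemma add_hom: "\<lbrakk>f \<in> Hom C X Y; g \<in> Hom C X Y\<rbrakk> \<Longrightarrow> f \<^bold>+ g \<in> Hom C X Y"
  using monoid.m_closed[OF group.is_monoid[OF comm_group.axioms(2)[OF hom_comm_group]], of X Y f g]
    Hom_obj[of f X Y] by (simp add: hom_group_def)

lemma neg_hom: "f \<in> Hom C X Y \<Longrightarrow> neg f \<in> Hom C X Y"
  using group.inv_closed[OF comm_group.axioms(2)[OF hom_comm_group], of X Y f]
    Hom_obj[of f X Y] by (simp add: hom_group_def neg_def) (simp add: Hom_def)

lemma add_assoc:
  "\<lbrakk>f \<in> Hom C X Y; g \<in> Hom C X Y; h \<in> Hom C X Y\<rbrakk> \<Longrightarrow> f \<^bold>+ g \<^bold>+ h = f \<^bold>+ (g \<^bold>+ h)"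
  using monoid.m_assoc[OF group.is_monoid[OF comm_group.axioms(2)[OF hom_comm_group]], of X Y f g h]
    Hom_obj[of f X Y] by (simp add: hom_group_def)

lemma add_comm: "\<lbrakk>f \<in> Hom C X Y; g \<in> Hom C X Y\<rbrakk> \<Longrightarrow> f \<^bold>+ g = g \<^bold>+ f"
  using comm_monoid.m_comm[OF comm_group.axioms(1)[OF hom_comm_group], of X Y f g]
    Hom_obj[of f X Y] by (simp add: hom_group_def)

lemma add_zero: "f \<in> Hom C X Y \<Longrightarrow> f \<^bold>+ zero_arr C X Y = f"
  using monoid.r_one[OF group.is_monoid[OF comm_group.axioms(2)[OF hom_comm_group]], of X Y f]
    Hom_obj[of f X Y] by (simp add: hom_group_def)

lemma zero_add: "f \<in> Hom C X Y \<Longrightarrow> zero_arr C X Y \<^bold>+ f = f"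
  using monoid.l_one[OF group.is_monoid[OF comm_group.axioms(2)[OF hom_comm_group]], of X Y f]
    Hom_obj[of f X Y] by (simp add: hom_group_def)

lemma add_neg: "f \<in> Hom C X Y \<Longrightarrow> f \<^bold>+ neg f = zero_arr C X Y"
  using group.r_inv[OF comm_group.axioms(2)[OF hom_comm_group], of X Y f]
    Hom_obj[of f X Y] by (simp add: hom_group_def neg_def) (simp add: Hom_def)

lemma neg_add: "f \<in> Hom C X Y \<Longrightarrow> neg f \<^bold>+ f = zero_arr C X Y"
  using add_neg[of f X Y] add_comm[of f X Y "neg f"] neg_hom[of f X Y] by simp

lemma add_left_cancel:
  assumes "f \<in> Hom C X Y" "g \<in> Hom C X Y" "h \<in> Hom C X Y" "f \<^bold>+ g = f \<^bold>+ h"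
  shows "g = h"
  by (metis assms add_assoc[of "neg f" X Y f] neg_hom[of f] neg_add[of f] zero_add)

lemma comp_zero:
  assumes "h \<in> Hom C Y Z" "X \<in> obj C"
  shows "h \<cdot> zero_arr C X Y = zero_arr C X Z"
proof -
  have z: "zero_arr C X Y \<in> Hom C X Y" "zero_arr C X Z \<in> Hom C X Z"
    using assms Hom_obj by (auto intro: zero_hom)
  let ?z = "h \<cdot> zero_arr C X Y"
  have "?z \<in> Hom C X Z" using z assms comp_hom by blast
  moreover have "?z \<^bold>+ ?z = ?z \<^bold>+ zero_arr C X Z"
    using comp_add_right[OF z(1) z(1) assms(1)] by (simp add: add_zero z calculation)
  ultimately show ?thesis using add_left_cancel z by blast
qed

end

lemma (in preadditive_category) zero_comp:
  assumes "h \<in> Hom C X Y" "Z \<in> obj C"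
  shows "zero_arr C Y Z \<cdot> h = zero_arr C X Z"
  using preadditive_category.comp_zero
    [OF opposite_preadditive_category[OF preadditive_category_axioms], of h Y X Z] assms
  by simp

context preadditive_category
begin

lemma comp_neg:
  assumes "f \<in> Hom C X Y" "h \<in> Hom C Y Z"
  shows "h \<cdot> neg f = neg (h \<cdot> f)"
proof (rule add_left_cancel)
  show "h \<cdot> f \<^bold>+ h \<cdot> neg f = h \<cdot> f \<^bold>+ neg (h \<cdot> f)"
    using comp_add_right[OF assms(1) neg_hom[OF assms(1)] assms(2), symmetric]
      add_neg[OF assms(1)] add_neg[OF comp_hom[OF assms]] comp_zero[OF assms(2)] Hom_obj[OF assms(1)]
    by simp
qed (use assms comp_hom neg_hom in \<open>blast+\<close>)

lemma eq_if_diff_zero: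
  assumes "f \<in> Hom C X Y" "g \<in> Hom C X Y" "f \<^bold>+ neg g = zero_arr C X Y"
  shows "f = g"
  using add_assoc[OF assms(1) neg_hom[OF assms(2)] assms(2)] assms
  by (simp add: neg_add[OF assms(2)] add_zero zero_add)

lemma add_neg_cancel:
  assumes "f \<in> Hom C X Y" "g \<in> Hom C X Y"
  shows "g \<^bold>+ (f \<^bold>+ neg g) = f"
  using add_assoc[OF assms(1) neg_hom[OF assms(2)] assms(2)] neg_hom[OF assms(2)]
    add_comm[OF assms(2) add_hom[OF assms(1) neg_hom[OF assms(2)]]] assms
  by (simp add: neg_add[OF assms(2)] add_zero)

text \<open>The identity of a direct sum is the sum of the arrows \<open>i k \<cdot> p k\<close>; so a property that is closed
  under addition, such as factoring through a given arrow, spreads from them to the identity.\<close>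

lemma direct_sum_induct:
  assumes "is_direct_sum C n A S i p"
    and "P (zero_arr C S S)"
    and "\<And>a b. \<lbrakk>a \<in> Hom C S S; b \<in> Hom C S S; P a; P b\<rbrakk> \<Longrightarrow> P (a \<^bold>+ b)"
    and "\<And>k. k < n \<Longrightarrow> P (i k \<cdot> p k)"
  shows "P (ident C S)"
proof -
  have S: "S \<in> obj C" using assms(1) by (simp add: is_direct_sum_def)
  interpret comm_group "hom_group C S S" by (rule hom_comm_group[OF S S])
  have ip: "i k \<cdot> p k \<in> Hom C S S" if "k < n" for k
    using assms(1) that comp_hom by (fastforce simp: is_direct_sum_def)
  have *: "finsum (end_ring C S) F N = finprod (hom_group C S S) F N" for F and N :: "nat set"
    by (simp add: finsum_def end_ring_def hom_group_def)
  let ?s = "\<lambda>m. finprod (hom_group C S S) (\<lambda>k. i k \<cdot> p k) {..<m}"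
  have "P (?s m)" if "m \<le> n" for m
    using that
  proof (induction m)
    case 0
    have "?s 0 = zero_arr C S S"
      by (simp only: lessThan_0 finprod_empty) (simp add: hom_group_def)
    then show ?case using assms(2) by simp
  next
    case (Suc m)
    have c: "(\<lambda>k. i k \<cdot> p k) \<in> {..<m} \<rightarrow> carrier (hom_group C S S)"
      using ip Suc.prems by (auto simp: hom_group_def)
    have m: "i m \<cdot> p m \<in> Hom C S S" using ip Suc.prems by simp
    have "?s (Suc m) = i m \<cdot> p m \<otimes>\<^bsub>hom_group C S S\<^esub> ?s m"
      unfolding lessThan_Suc
      by (rule finprod_insert[OF _ _ c]) (use m in \<open>auto simp: hom_group_def\<close>)
    also have "\<dots> = i m \<cdot> p m \<^bold>+ ?s m"
      by (simp only: hom_group_def monoid.simps)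
    finally have "?s (Suc m) = i m \<cdot> p m \<^bold>+ ?s m" .
    moreover have "?s m \<in> Hom C S S"
      using finprod_closed[OF c] by (simp only: hom_group_def partial_object.simps)
    moreover have "P (?s m)" "P (i m \<cdot> p m)"
      using Suc assms(4)[of m] by auto
    ultimately show ?case
      using assms(3)[OF m] by (simp only:)
  qed
  then have "P (?s n)" by simp
  moreover have "?s n = ident C S"
    using assms(1) by (simp only: is_direct_sum_def *)
  ultimately show ?thesis by simp
qed

end

lemma (in preadditive_category) neg_comp:
  assumes "f \<in> Hom C X Y" "h \<in> Hom C Y Z"
  shows "neg h \<cdot> f = neg (h \<cdot> f)"
proof (rule add_left_cancel)
  show "h \<cdot> f \<^bold>+ neg h \<cdot> f = h \<cdot> f \<^bold>+ neg (h \<cdot> f)"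
    using comp_add_left[OF assms(1) assms(2) neg_hom[OF assms(2)], symmetric]
      add_neg[OF assms(2)] add_neg[OF comp_hom[OF assms]] zero_comp[OF assms(1)] Hom_obj[OF assms(2)]
    by simp
qed (use assms comp_hom neg_hom in \<open>blast+\<close>)

section \<open>Local endomorphism rings\<close>

context preadditive_category
begin

lemma ring_end_ring:
  assumes X: "X \<in> obj C"
  shows "ring (end_ring C X)"
proof (rule ringI)
  show "abelian_group (end_ring C X)"
  proof (rule abelian_groupI)
    fix a assume "a \<in> carrier (end_ring C X)"
    then have "neg a \<in> carrier (end_ring C X)" "neg a \<oplus>\<^bsub>end_ring C X\<^esub> a = \<zero>\<^bsub>end_ring C X\<^esub>"
      using neg_hom neg_add by (simp_all add: end_ring_def)
    then show "\<exists>b \<in> carrier (end_ring C X). b \<oplus>\<^bsub>end_ring C X\<^esub> a = \<zero>\<^bsub>end_ring C X\<^esub>"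
      by blast
  qed (auto simp: end_ring_def X intro: add_hom zero_hom zero_add add_assoc add_comm)
  show "monoid (end_ring C X)"
    by (rule monoidI) (use X ident_hom comp_hom comp_assoc ident_comp comp_ident in
        \<open>auto simp: end_ring_def\<close>)
qed (use comp_add_left comp_add_right in \<open>auto simp: end_ring_def\<close>)

lemma Units_end_ring: "Units (end_ring C X) = {a \<in> Hom C X X. iso_arr C a}"
  by (auto simp: Units_def end_ring_def iso_arr_iff)

lemma local_ring_end_iff:
  assumes "X \<in> obj C"
  shows "local_ring (end_ring C X) \<longleftrightarrow> ident C X \<noteq> zero_arr C X X \<and>
    (\<forall>a \<in> Hom C X X. \<forall>b \<in> Hom C X X. iso_arr C (a \<^bold>+ b) \<longrightarrow> iso_arr C a \<or> iso_arr C b)"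
  using ring_end_ring[OF assms] add_hom
  unfolding local_ring_def Units_end_ring by (auto simp: end_ring_def)

lemma local_ring_end_opposite:
  assumes "X \<in> obj C"
  shows "local_ring (end_ring (opposite C) X) \<longleftrightarrow> local_ring (end_ring C X)"
  using preadditive_category.local_ring_end_iff
    [OF opposite_preadditive_category[OF preadditive_category_axioms], of X] assms
  by (simp add: local_ring_end_iff)

text \<open>A left invertible \<open>a\<close> with \<open>r a = 1\<close> is invertible: \<open>e = a r\<close> is idempotent and
  \<open>e + (1 - e) = 1\<close>, so \<open>e\<close> or \<open>1 - e\<close> is left invertible, hence equal to \<open>1\<close>. In the first case
  \<open>r\<close> is a two-sided inverse; the second gives \<open>a r = 0\<close> and \<open>1 = r (a r) a = 0\<close>. Thus left
  invertible elements are units, and closure of non-sections under addition is locality.\<close>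

lemma local_ring_end_of_sections:
  assumes X: "X \<in> obj C" and nz: "ident C X \<noteq> zero_arr C X X"
    and add: "\<And>a b. \<lbrakk>a \<in> Hom C X X; b \<in> Hom C X X; section_arr C (a \<^bold>+ b)\<rbrakk>
      \<Longrightarrow> section_arr C a \<or> section_arr C b"
  shows "local_ring (end_ring C X)"
proof -
  have iso: "iso_arr C a" if a: "a \<in> Hom C X X" "section_arr C a" for a
  proof -
    obtain r where r: "r \<in> Hom C X X" "r \<cdot> a = ident C X"
      using a section_arr_iff by blast
    define e where "e = a \<cdot> r"
    have e: "e \<in> Hom C X X" using a r comp_hom unfolding e_def by blast
    have "e \<cdot> e = a \<cdot> (r \<cdot> a) \<cdot> r"
      using a(1) r(1) unfolding e_def by (auto simp: Hom_def)
    then have ee: "e \<cdot> e = e"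
      using a(1) r by (auto simp: Hom_def e_def)
    define d where "d = ident C X \<^bold>+ neg e"
    have d: "d \<in> Hom C X X" unfolding d_def by (intro add_hom neg_hom ident_hom X e)
    have de: "d \<cdot> e = zero_arr C X X"
      using comp_add_left[OF e ident_hom[OF X] neg_hom[OF e]] neg_comp[OF e e] add_neg[OF e] ee e
      by (simp add: d_def Hom_def)
    have "e \<^bold>+ d = ident C X"
      unfolding d_def by (rule add_neg_cancel[OF ident_hom[OF X] e])
    moreover have "section_arr C (ident C X)"
      using section_arr_iff[OF ident_hom[OF X]] ident_hom[OF X] ident_comp by blast
    ultimately consider "section_arr C e" | "section_arr C d"
      using add[OF e d] by auto
    then have "e = ident C X"
    proof cases
      case 1
      then obtain s where s: "s \<in> Hom C X X" "s \<cdot> e = ident C X"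
        using section_arr_iff[OF e] by blast
      have "e = (s \<cdot> e) \<cdot> e" using s(2) ident_comp[OF e] by simp
      also have "\<dots> = ident C X" using comp_assoc[OF e e s(1)] ee s(2) by simp
      finally show ?thesis .
    next
      case 2
      then obtain s where s: "s \<in> Hom C X X" "s \<cdot> d = ident C X"
        using section_arr_iff[OF d] by blast
      have "e = (s \<cdot> d) \<cdot> e" using s(2) ident_comp[OF e] by simp
      also have "\<dots> = zero_arr C X X"
        using comp_assoc[OF e d s(1)] de comp_zero[OF s(1) X] by simp
      finally have e0: "e = zero_arr C X X" .
      have "ident C X = (r \<cdot> a) \<cdot> (r \<cdot> a)" using r(2) ident_comp[OF ident_hom[OF X]] by simp
      also have "\<dots> = r \<cdot> e \<cdot> a" using a(1) r(1) by (auto simp: Hom_def e_def)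
      also have "\<dots> = zero_arr C X X"
        using e0 comp_zero[OF r(1) X] zero_comp[OF a(1) X] by simp
      finally show ?thesis using nz by simp
    qed
    then show ?thesis
      using r iso_arr_iff[OF a(1)] unfolding e_def by blast
  qed
  show ?thesis
    unfolding local_ring_end_iff[OF X]
    using nz add iso iso_arr_section by blast
qed

text \<open>Non-sections in \<open>End X\<close> factor through \<open>f\<close>, hence so does their sum, and \<open>f\<close> is not a
  section. If \<open>X\<close> were a zero object, \<open>f\<close> would be a section.\<close>

lemma left_almost_split_local_ring_end:
  assumes f: "left_almost_split C f" "f \<in> Hom C X Y"
  shows "local_ring (end_ring C X)"
proof (rule local_ring_end_of_sections)
  show X: "X \<in> obj C" using Hom_obj f by blast
  have ns: "\<not> section_arr C f" using f(1) by (simp add: left_almost_split_def)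
  show "ident C X \<noteq> zero_arr C X X"
    using ns section_arr_iff[OF f(2)] zero_comp[OF f(2) X] zero_hom Hom_obj[OF f(2)] by metis
  fix a b assume ab: "a \<in> Hom C X X" "b \<in> Hom C X X" "section_arr C (a \<^bold>+ b)"
  show "section_arr C a \<or> section_arr C b"
  proof (rule ccontr)
    assume *: "\<not> ?thesis"
    obtain v where v: "v \<in> Hom C Y X" "a = v \<cdot> f"
      using left_almost_splitD[OF f ab(1)] * by blast
    obtain w where w: "w \<in> Hom C Y X" "b = w \<cdot> f"
      using left_almost_splitD[OF f ab(2)] * by blast
    have "a \<^bold>+ b = (v \<^bold>+ w) \<cdot> f"
      using comp_add_left[OF f(2) v(1) w(1)] v(2) w(2) by simp
    then show False
      using ab(3) section_arr_of_comp[OF f(2) add_hom[OF v(1) w(1)]] ns by simp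
  qed
qed

lemma local_ring_end_iso:
  assumes i: "i \<in> Hom C A Z" and p: "p \<in> Hom C Z A"
    and p_i: "p \<cdot> i = ident C A" and i_p: "i \<cdot> p = ident C Z"
    and loc: "local_ring (end_ring C A)"
  shows "local_ring (end_ring C Z)"
proof -
  have A: "A \<in> obj C" and Z: "Z \<in> obj C" using i Hom_obj by auto
  \<comment> \<open>Conjugation \<open>t\<close> is an isomorphism from \<open>End Z\<close> onto \<open>End A\<close>.\<close>
  define t where "t a = p \<cdot> (a \<cdot> i)" for a
  have t: "t a \<in> Hom C A A" if "a \<in> Hom C Z Z" for a
    using that i p comp_hom unfolding t_def by blast
  have t_comp: "t (a \<cdot> b) = t a \<cdot> t b" if "a \<in> Hom C Z Z" "b \<in> Hom C Z Z" for a b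
  proof -
    have "t a \<cdot> t b = p \<cdot> a \<cdot> (i \<cdot> p) \<cdot> b \<cdot> i"
      using that i p unfolding t_def by (auto simp: Hom_def)
    also have "\<dots> = t (a \<cdot> b)" using that i p unfolding t_def i_p by (auto simp: Hom_def)
    finally show ?thesis by simp
  qed
  have conj_inv: "i \<cdot> (t a \<cdot> p) = a" if a: "a \<in> Hom C Z Z" for a
  proof -
    have "i \<cdot> (t a \<cdot> p) = (i \<cdot> p) \<cdot> a \<cdot> (i \<cdot> p)"
      using a i p unfolding t_def by (auto simp: Hom_def)
    also have "\<dots> = a" using a unfolding i_p by (auto simp: Hom_def)
    finally show ?thesis .
  qed
  have t1: "t (ident C Z) = ident C A" using p_i i by (auto simp: Hom_def t_def)
  have t_add: "t (a \<^bold>+ b) = t a \<^bold>+ t b" if "a \<in> Hom C Z Z" "b \<in> Hom C Z Z" for a b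
    using comp_add_left[OF i that] comp_add_right[OF comp_hom[OF i that(1)] comp_hom[OF i that(2)] p]
    by (simp add: t_def)
  have iso1: "iso_arr C (t a)" if a: "a \<in> Hom C Z Z" "iso_arr C a" for a
    using a t t_comp t1 iso_arr_iff by metis
  have iso2: "iso_arr C a" if a: "a \<in> Hom C Z Z" "iso_arr C (t a)" for a
  proof -
    obtain c where c: "c \<in> Hom C A A" "c \<cdot> t a = ident C A" "t a \<cdot> c = ident C A"
      using a iso_arr_iff[OF t] by blast
    define d where "d = i \<cdot> (c \<cdot> p)"
    have d: "d \<in> Hom C Z Z" using c i p comp_hom unfolding d_def by blast
    have "t d = (p \<cdot> i) \<cdot> c \<cdot> (p \<cdot> i)"
      using c(1) i p unfolding t_def d_def by (auto simp: Hom_def)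
    then have td: "t d = c" using c(1) unfolding p_i by (auto simp: Hom_def)
    have "d \<cdot> a = ident C Z" "a \<cdot> d = ident C Z"
      using conj_inv[OF comp_hom[OF a(1) d]] conj_inv[OF comp_hom[OF d a(1)]] conj_inv[OF ident_hom[OF Z]]
        t_comp[OF a(1) d] t_comp[OF d a(1)] c td t1 by simp_all
    then show ?thesis using iso_arr_iff[OF a(1)] d by blast
  qed
  have nz: "ident C Z \<noteq> zero_arr C Z Z"
  proof
    assume "ident C Z = zero_arr C Z Z"
    then have "ident C A = zero_arr C A A"
      using t1 zero_comp[OF i Z] comp_zero[OF p A] by (simp add: t_def)
    then show False using loc local_ring_end_iff[OF A] by blast
  qed
  show ?thesis
    unfolding local_ring_end_iff[OF Z]
    using nz loc t t_add iso1 iso2 add_hom unfolding local_ring_end_iff[OF A] by metis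
qed

text \<open>The ring-theoretic fact that \<open>1 + f t\<close> is invertible as soon as \<open>1 + t f\<close> is, for arrows in
  opposite directions: if \<open>w\<close> is the inverse of \<open>1 + t f\<close>, then \<open>1 - f w t\<close> is that of \<open>1 + f t\<close>.\<close>

lemma one_plus_comp_iso:
  assumes f: "f \<in> Hom C X Y" and t: "t \<in> Hom C Y X"
    and iso: "iso_arr C (ident C X \<^bold>+ t \<cdot> f)"
  shows "iso_arr C (ident C Y \<^bold>+ f \<cdot> t)"
proof -
  have X: "X \<in> obj C" and Y: "Y \<in> obj C" using f Hom_obj by auto
  have tf: "t \<cdot> f \<in> Hom C X X" and ft: "f \<cdot> t \<in> Hom C Y Y" using f t comp_hom by blast+
  obtain w where w: "w \<in> Hom C X X" "w \<cdot> (ident C X \<^bold>+ t \<cdot> f) = ident C X"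
      "(ident C X \<^bold>+ t \<cdot> f) \<cdot> w = ident C X"
    using iso iso_arr_iff[OF add_hom[OF ident_hom[OF X] tf]] by blast
  define d where "d = f \<cdot> (w \<cdot> t)"
  have d: "d \<in> Hom C Y Y" using f w t comp_hom unfolding d_def by blast
  define e where "e = ident C Y \<^bold>+ neg d"
  have e: "e \<in> Hom C Y Y" unfolding e_def by (intro add_hom ident_hom neg_hom Y d)
  have de: "d \<^bold>+ e = ident C Y"
    unfolding e_def by (rule add_neg_cancel[OF ident_hom[OF Y] d])
  let ?a = "ident C Y \<^bold>+ f \<cdot> t"
  have a: "?a \<in> Hom C Y Y" by (intro add_hom ident_hom ft Y)
  have wt: "w \<cdot> t \<in> Hom C Y X" and fw: "f \<cdot> w \<in> Hom C X Y" using w t f comp_hom by blast+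
  have 1: "?a \<cdot> d = f \<cdot> t"
  proof -
    have "?a \<cdot> d = f \<cdot> (w \<cdot> t) \<^bold>+ f \<cdot> ((t \<cdot> f) \<cdot> (w \<cdot> t))"
      using comp_add_left[OF d ident_hom[OF Y] ft] f t w(1) by (auto simp: Hom_def d_def)
    also have "\<dots> = f \<cdot> ((ident C X \<^bold>+ t \<cdot> f) \<cdot> (w \<cdot> t))"
      using comp_add_right[OF wt comp_hom[OF wt tf] f] comp_add_left[OF wt ident_hom[OF X] tf]
        ident_comp[OF wt] by simp
    also have "\<dots> = f \<cdot> t"
      using comp_assoc[OF t w(1) add_hom[OF ident_hom[OF X] tf]] w(3) ident_comp[OF t] by simp
    finally show ?thesis .
  qed
  have 2: "d \<cdot> ?a = f \<cdot> t"
  proof -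
    have "d \<cdot> ?a = (f \<cdot> w) \<cdot> t \<^bold>+ (f \<cdot> w) \<cdot> ((t \<cdot> f) \<cdot> t)"
      using comp_add_right[OF ident_hom[OF Y] ft d] f t w(1) by (auto simp: Hom_def d_def)
    also have "\<dots> = (f \<cdot> w) \<cdot> ((ident C X \<^bold>+ t \<cdot> f) \<cdot> t)"
      using comp_add_right[OF t comp_hom[OF t tf] fw] comp_add_left[OF t ident_hom[OF X] tf]
        ident_comp[OF t] by simp
    also have "\<dots> = f \<cdot> (w \<cdot> (ident C X \<^bold>+ t \<cdot> f) \<cdot> t)"
      using comp_assoc[OF comp_hom[OF t add_hom[OF ident_hom[OF X] tf]] w(1) f]
        comp_assoc[OF t add_hom[OF ident_hom[OF X] tf] w(1)] by simp
    also have "\<dots> = f \<cdot> t"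
      using w(2) ident_comp[OF t] by simp
    finally show ?thesis .
  qed
  have "f \<cdot> t \<^bold>+ ?a \<cdot> e = f \<cdot> t \<^bold>+ ident C Y"
    using comp_add_right[OF d e a] 1 de comp_ident[OF a] add_comm[OF ident_hom[OF Y] ft] by simp
  then have 3: "?a \<cdot> e = ident C Y"
    using add_left_cancel ft comp_hom[OF e a] ident_hom[OF Y] by blast
  have "f \<cdot> t \<^bold>+ e \<cdot> ?a = f \<cdot> t \<^bold>+ ident C Y"
    using comp_add_left[OF a d e] 2 de ident_comp[OF a] add_comm[OF ident_hom[OF Y] ft] by simp
  then have "e \<cdot> ?a = ident C Y"
    using add_left_cancel ft comp_hom[OF a e] ident_hom[OF Y] by blast
  then show ?thesis using 3 e iso_arr_iff[OF a] by blast
qed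

text \<open>As \<open>f\<close> is not a section, \<open>- t f\<close> is not invertible, but its sum with \<open>1 + t f\<close> is \<open>1\<close>.\<close>

lemma one_plus_iso_of_local:
  assumes f: "f \<in> Hom C X Y" "\<not> section_arr C f" and t: "t \<in> Hom C Y X"
    and loc: "local_ring (end_ring C X)"
  shows "iso_arr C (ident C X \<^bold>+ t \<cdot> f)"
proof -
  have X: "X \<in> obj C" using f Hom_obj by auto
  have tf: "t \<cdot> f \<in> Hom C X X" using f t comp_hom by blast
  let ?a = "ident C X \<^bold>+ t \<cdot> f"
  have a: "?a \<in> Hom C X X" by (intro add_hom ident_hom X tf)
  have "?a \<^bold>+ neg (t \<cdot> f) = ident C X"
    using add_assoc[OF ident_hom[OF X] tf neg_hom[OF tf]] add_neg[OF tf] add_zero[OF ident_hom[OF X]]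
    by simp
  moreover have "iso_arr C (ident C X)"
    using iso_arr_iff[OF ident_hom[OF X]] ident_hom[OF X] ident_comp by blast
  ultimately have "iso_arr C ?a \<or> iso_arr C (neg (t \<cdot> f))"
    using loc a neg_hom[OF tf] unfolding local_ring_end_iff[OF X] by metis
  moreover have "\<not> iso_arr C (neg (t \<cdot> f))"
    using neg_comp[OF f(1) t] section_arr_of_comp[OF f(1) neg_hom[OF t]] f(2) iso_arr_section
    by auto
  ultimately show ?thesis by blast
qed

end

section \<open>Kernels, cokernels and minimality\<close>

context preadditive_category
begin

lemma is_cokernel_epi:
  assumes "is_cokernel C g f" "g \<in> Hom C Y Z" "u \<in> Hom C Z W" "v \<in> Hom C Z W" "u \<cdot> g = v \<cdot> g"
  shows "u = v"
proof -
  define X where "X = src C f"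
  have f: "f \<in> Hom C X Y" using assms by (auto simp: is_cokernel_def Hom_def X_def)
  have gf: "g \<cdot> f = zero_arr C X Z" using assms by (auto simp: is_cokernel_def Hom_def X_def)
  have "(u \<cdot> g) \<cdot> f = zero_arr C X W"
    using comp_assoc[OF f assms(2,3)] gf comp_zero[OF assms(3)] Hom_obj[OF f] by simp
  moreover have "u \<cdot> g \<in> Hom C (tgt C f) W"
    using comp_hom[OF assms(2,3)] f by (auto simp: Hom_def)
  ultimately have "\<exists>!u'. u' \<in> Hom C (tgt C g) W \<and> u \<cdot> g = u' \<cdot> g"
    using assms(1) by (simp add: is_cokernel_def X_def)
  then have "\<exists>!u'. u' \<in> Hom C Z W \<and> u \<cdot> g = u' \<cdot> g"
    using assms(2) by (simp add: Hom_def)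
  then show ?thesis using assms(3-5) by blast
qed

end

lemma (in preadditive_category) is_kernel_mono:
  assumes "is_kernel C f g" "f \<in> Hom C X Y" "u \<in> Hom C W X" "v \<in> Hom C W X" "f \<cdot> u = f \<cdot> v"
  shows "u = v"
  using preadditive_category.is_cokernel_epi
    [OF opposite_preadditive_category[OF preadditive_category_axioms], of f g Y X u W v] assms
  by simp

context preadditive_category
begin

lemma is_kernelE:
  assumes "is_kernel C f g" "f \<in> Hom C X Y" "g \<in> Hom C Y Z" "k \<in> Hom C V Y"
    "g \<cdot> k = zero_arr C V Z"
  obtains u where "u \<in> Hom C V X" "k = f \<cdot> u"
proof -
  have "src C f = X" "src C g = Y" "tgt C g = Z" using assms(2,3) by (auto simp: Hom_def)
  then show ?thesis using assms that unfolding is_kernel_def by blast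
qed

lemma is_cokernelE:
  assumes "is_cokernel C g f" "f \<in> Hom C X Y" "g \<in> Hom C Y Z" "k \<in> Hom C Y V"
    "k \<cdot> f = zero_arr C X V"
  obtains u where "u \<in> Hom C Z V" "k = u \<cdot> g"
proof -
  have "tgt C g = Z" "src C f = X" "tgt C f = Y" using assms(2,3) by (auto simp: Hom_def)
  then show ?thesis using assms that unfolding is_cokernel_def by blast
qed

text \<open>If \<open>r f = 1\<close>, then \<open>1 - f r\<close> vanishes on \<open>f\<close>, so it factors as \<open>s g\<close>; cancelling the epi \<open>g\<close>
  in \<open>g s g = g\<close> gives \<open>g s = 1\<close>.\<close>

lemma cokernel_of_section_retraction:
  assumes cok: "is_cokernel C g f" and f: "f \<in> Hom C X Y" and g: "g \<in> Hom C Y Z"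
    and sec: "section_arr C f"
  shows "retraction_arr C g"
proof -
  have X: "X \<in> obj C" and Y: "Y \<in> obj C" and Z: "Z \<in> obj C" using f g Hom_obj by auto
  have gf: "g \<cdot> f = zero_arr C X Z" using cok f g by (auto simp: is_cokernel_def Hom_def)
  obtain r where r: "r \<in> Hom C Y X" "r \<cdot> f = ident C X"
    using sec section_arr_iff[OF f] by blast
  have fr: "f \<cdot> r \<in> Hom C Y Y" using f r comp_hom by blast
  define k where "k = ident C Y \<^bold>+ neg (f \<cdot> r)"
  have k: "k \<in> Hom C Y Y" unfolding k_def by (intro add_hom ident_hom neg_hom fr Y)
  have "(f \<cdot> r) \<cdot> f = f"
    using comp_assoc[OF f r(1) f] r(2) comp_ident[OF f] by simp
  then have "k \<cdot> f = zero_arr C X Y"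
    using comp_add_left[OF f ident_hom[OF Y] neg_hom[OF fr]] neg_comp[OF f fr] add_neg[OF f]
      ident_comp[OF f] by (simp add: k_def)
  then obtain s where s: "s \<in> Hom C Z Y" "k = s \<cdot> g"
    using is_cokernelE[OF cok f g k] by blast
  have "g \<cdot> (f \<cdot> r) = zero_arr C Y Z"
    using comp_assoc[OF r(1) f g] gf zero_comp[OF r(1) Z] by simp
  then have "g \<cdot> k = g"
    using comp_add_right[OF ident_hom[OF Y] neg_hom[OF fr] g] comp_neg[OF fr g]
      add_zero[OF g] neg_hom[OF zero_hom[OF Y Z]] zero_add[OF neg_hom[OF zero_hom[OF Y Z]]]
      add_neg[OF zero_hom[OF Y Z]] comp_ident[OF g] by (simp add: k_def)
  then have "(g \<cdot> s) \<cdot> g = ident C Z \<cdot> g"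
    using comp_assoc[OF g s(1) g] s(2) ident_comp[OF g] by simp
  then have "g \<cdot> s = ident C Z"
    using is_cokernel_epi[OF cok g] comp_hom[OF s(1) g] ident_hom[OF Z] by blast
  then show ?thesis using s(1) retraction_arr_iff[OF g] by blast
qed

text \<open>If \<open>g h = g\<close>, then \<open>h - 1\<close> factors through the kernel \<open>f\<close>, so \<open>h = 1 + f t\<close>; its
  invertibility is moved to that of \<open>1 + t f\<close> in the local ring \<open>End X\<close>.\<close>

lemma right_minimal_of_kernel:
  assumes ker: "is_kernel C f g" and f: "f \<in> Hom C X Y" "\<not> section_arr C f" and g: "g \<in> Hom C Y Z"
    and loc: "local_ring (end_ring C X)"
  shows "right_minimal C g"
proof -
  have Y: "Y \<in> obj C" and Z: "Z \<in> obj C" using g Hom_obj by auto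
  have "iso_arr C h" if h: "h \<in> Hom C Y Y" "g \<cdot> h = g" for h
  proof -
    define k where "k = h \<^bold>+ neg (ident C Y)"
    have k: "k \<in> Hom C Y Y" unfolding k_def by (intro add_hom ident_hom neg_hom h Y)
    have "g \<cdot> k = zero_arr C Y Z"
      using comp_add_right[OF h(1) neg_hom[OF ident_hom[OF Y]] g] comp_neg[OF ident_hom[OF Y] g]
        add_neg[OF g] comp_ident[OF g] h(2) by (simp add: k_def)
    then obtain t where t: "t \<in> Hom C Y X" "k = f \<cdot> t"
      using is_kernelE[OF ker f(1) g k] by blast
    have "h = ident C Y \<^bold>+ f \<cdot> t"
      using add_neg_cancel[OF h(1) ident_hom[OF Y]] t(2) by (simp add: k_def)
    then show ?thesis
      using one_plus_comp_iso[OF f(1) t(1) one_plus_iso_of_local[OF f t(1) loc]] by simp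
  qed
  then show ?thesis
    using g unfolding right_minimal_def by (auto simp: Hom_def)
qed

end

lemma (in preadditive_category) section_of_retraction_kernel:
  assumes "is_kernel C f g" "f \<in> Hom C X Y" "g \<in> Hom C Y Z" "retraction_arr C g"
  shows "section_arr C f"
  using preadditive_category.cokernel_of_section_retraction
    [OF opposite_preadditive_category[OF preadditive_category_axioms], of f g Z Y X] assms
  by simp

section \<open>Pushouts and pullbacks of stable exact sequences\<close>

context preabelian_category
begin

text \<open>The pushout is the cokernel of \<open>d = i 0 \<cdot> a - i 1 \<cdot> f\<close> into the direct sum of \<open>X'\<close> and \<open>Y\<close>.\<close>

lemma has_pushout:
  assumes a: "a \<in> Hom C X X'" and f: "f \<in> Hom C X Y"
  obtains P f' a' where "is_pushout C a f f' a'" "f' \<in> Hom C X' P" "a' \<in> Hom C Y P"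
proof -
  have X: "X \<in> obj C" and X': "X' \<in> obj C" and Y: "Y \<in> obj C"
    using a f Hom_obj by auto
  define A where "A k = (if k = 0 then X' else Y)" for k :: nat
  obtain S i p where S: "is_direct_sum C 2 A S i p"
    using has_direct_sums[of 2 A] X' Y unfolding A_def by metis
  have 2: "(0::nat) < 2" "(1::nat) < 2" by auto
  have A: "A 0 = X'" "A 1 = Y" by (simp_all add: A_def)
  have ip: "i 0 \<in> Hom C X' S" "i 1 \<in> Hom C Y S" "p 0 \<in> Hom C S X'" "p 1 \<in> Hom C S Y"
    using S 2 A unfolding is_direct_sum_def by metis+
  have pi: "p 0 \<cdot> i 0 = ident C X'" "p 1 \<cdot> i 1 = ident C Y"
    "p 0 \<cdot> i 1 = zero_arr C Y X'" "p 1 \<cdot> i 0 = zero_arr C X' Y"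
    using S 2 A unfolding is_direct_sum_def by (metis zero_neq_one)+
  have S': "S \<in> obj C" using S by (simp add: is_direct_sum_def)
  have joint_epi: "v = w" if v: "v \<in> Hom C S W" and w: "w \<in> Hom C S W"
    and 0: "v \<cdot> i 0 = w \<cdot> i 0" and 1: "v \<cdot> i 1 = w \<cdot> i 1" for v w W
  proof -
    have "v \<cdot> ident C S = w \<cdot> ident C S"
    proof (rule direct_sum_induct[OF S, where P = "\<lambda>a. v \<cdot> a = w \<cdot> a"])
      show "v \<cdot> zero_arr C S S = w \<cdot> zero_arr C S S"
        using comp_zero[OF v S'] comp_zero[OF w S'] by simp
      show "v \<cdot> (a \<^bold>+ b) = w \<cdot> (a \<^bold>+ b)"
        if "a \<in> Hom C S S" "b \<in> Hom C S S" "v \<cdot> a = w \<cdot> a" "v \<cdot> b = w \<cdot> b" for a b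
        using comp_add_right[OF that(1,2) v] comp_add_right[OF that(1,2) w] that by simp
      fix k :: nat assume "k < 2"
      then have "k = 0 \<or> k = 1" by auto
      then show "v \<cdot> (i k \<cdot> p k) = w \<cdot> (i k \<cdot> p k)"
        using comp_assoc[OF ip(3,1) v] comp_assoc[OF ip(3,1) w] comp_assoc[OF ip(4,2) v]
          comp_assoc[OF ip(4,2) w] 0 1 by metis
    qed
    then show ?thesis using comp_ident[OF v] comp_ident[OF w] by simp
  qed
  define d where "d = i 0 \<cdot> a \<^bold>+ neg (i 1 \<cdot> f)"
  have i0a: "i 0 \<cdot> a \<in> Hom C X S" and i1f: "i 1 \<cdot> f \<in> Hom C X S"
    using a f ip comp_hom by blast+
  have d: "d \<in> Hom C X S"
    unfolding d_def by (intro add_hom neg_hom i0a i1f)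
  have vd: "v \<cdot> d = (v \<cdot> i 0) \<cdot> a \<^bold>+ neg ((v \<cdot> i 1) \<cdot> f)" if v: "v \<in> Hom C S W" for v W
    using comp_add_right[OF i0a neg_hom[OF i1f] v] comp_neg[OF i1f v]
      comp_assoc[OF a ip(1) v] comp_assoc[OF f ip(2) v] by (simp add: d_def)
  obtain c where c: "is_cokernel C c d"
    using has_cokernel[of d] d by (auto simp: Hom_def)
  define P where "P = tgt C c"
  have cS: "c \<in> Hom C S P" and cd: "c \<cdot> d = zero_arr C X P"
    using c d by (auto simp: is_cokernel_def Hom_def P_def)
  define f' where "f' = c \<cdot> i 0"
  define a' where "a' = c \<cdot> i 1"
  have f': "f' \<in> Hom C X' P" and a': "a' \<in> Hom C Y P"
    using cS ip comp_hom unfolding f'_def a'_def by blast+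
  have eq: "f' \<cdot> a = a' \<cdot> f"
  proof (rule eq_if_diff_zero)
    show "f' \<cdot> a \<in> Hom C X P" "a' \<cdot> f \<in> Hom C X P" using f' a' a f comp_hom by blast+
    show "f' \<cdot> a \<^bold>+ neg (a' \<cdot> f) = zero_arr C X P"
      using vd[OF cS] cd by (simp only: f'_def a'_def)
  qed
  have univ: "\<exists>!u. u \<in> Hom C P W \<and> u \<cdot> f' = q \<and> u \<cdot> a' = r"
    if q: "q \<in> Hom C X' W" and r: "r \<in> Hom C Y W" and qr: "q \<cdot> a = r \<cdot> f" for W q r
  proof -
    have W: "W \<in> obj C" using q Hom_obj by blast
    define w where "w = q \<cdot> p 0 \<^bold>+ r \<cdot> p 1"
    have qp: "q \<cdot> p 0 \<in> Hom C S W" and rp: "r \<cdot> p 1 \<in> Hom C S W"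
      using q r ip comp_hom by blast+
    have w: "w \<in> Hom C S W" unfolding w_def by (intro add_hom qp rp)
    have w0: "w \<cdot> i 0 = q"
      using comp_add_left[OF ip(1) qp rp] comp_assoc[OF ip(1,3) q] comp_assoc[OF ip(1,4) r]
        pi comp_ident[OF q] comp_zero[OF r X'] add_zero[OF q] by (simp add: w_def)
    have w1: "w \<cdot> i 1 = r"
      using comp_add_left[OF ip(2) qp rp] comp_assoc[OF ip(2,3) q] comp_assoc[OF ip(2,4) r]
        pi comp_ident[OF r] comp_zero[OF q Y] zero_add[OF r] by (simp add: w_def)
    have "w \<cdot> d = zero_arr C X W"
      using vd[OF w] add_neg[OF comp_hom[OF f r]] by (simp only: w0 w1 qr)
    then obtain u where u: "u \<in> Hom C P W" "w = u \<cdot> c"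
      using is_cokernelE[OF c d cS w] by blast
    show ?thesis
    proof (rule ex1I[of _ u])
      show "u \<in> Hom C P W \<and> u \<cdot> f' = q \<and> u \<cdot> a' = r"
        using u comp_assoc[OF ip(1) cS u(1)] comp_assoc[OF ip(2) cS u(1)] w0 w1
        by (simp add: f'_def a'_def)
    next
      fix u' assume u': "u' \<in> Hom C P W \<and> u' \<cdot> f' = q \<and> u' \<cdot> a' = r"
      then have u'': "u' \<in> Hom C P W" by blast
      have "u' \<cdot> c = w"
      proof (rule joint_epi)
        show "u' \<cdot> c \<in> Hom C S W" using u'' cS comp_hom by blast
        show "w \<in> Hom C S W" by (fact w)
        show "u' \<cdot> c \<cdot> i 0 = w \<cdot> i 0" "u' \<cdot> c \<cdot> i 1 = w \<cdot> i 1"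
          using comp_assoc[OF ip(1) cS u''] comp_assoc[OF ip(2) cS u''] w0 w1 u'
          by (simp_all add: f'_def a'_def)
      qed
      then have "u' \<cdot> c = u \<cdot> c" using u(2) by metis
      then show "u' = u" using is_cokernel_epi[OF c cS u'' u(1)] by blast
    qed
  qed
  have "is_pushout C a f f' a'"
    using a f f' a' eq univ unfolding is_pushout_def Hom_def by simp
  then show ?thesis using that f' a' by blast
qed

lemma stable_exact_hom:
  assumes "stable_exact C f g" "f \<in> Hom C X Y" "g \<in> Hom C Y Z"
  shows "is_kernel C f g" "is_cokernel C g f" "g \<cdot> f = zero_arr C X Z"
  using assms by (auto simp: stable_exact_def short_exact_def is_kernel_def Hom_def)

text \<open>The second arrow \<open>g'\<close> comes from the universal property of the pushout, applied to the pair
  \<open>0 : U \<rightarrow> Z\<close> and \<open>g\<close>, which is compatible because \<open>g f = 0\<close>.\<close>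

lemma stable_exact_pushout:
  assumes ex: "stable_exact C f g" and f: "f \<in> Hom C X Y" and g: "g \<in> Hom C Y Z"
    and u: "u \<in> Hom C X U"
  obtains P f' g' u' where "f' \<in> Hom C U P" "g' \<in> Hom C P Z" "u' \<in> Hom C Y P"
    "f' \<cdot> u = u' \<cdot> f" "g' \<cdot> u' = g" "short_exact C f' g'"
proof -
  have U: "U \<in> obj C" and Z: "Z \<in> obj C" using u g Hom_obj by auto
  obtain P f' u' where po: "is_pushout C u f f' u'" and f': "f' \<in> Hom C U P" and u': "u' \<in> Hom C Y P"
    using has_pushout[OF u f] by blast
  have st: "tgt C u = U" "tgt C f = Y" "tgt C f' = P" "src C f' = U" "tgt C g = Z"
    using u f f' g by (auto simp: Hom_def)
  have "zero_arr C U Z \<cdot> u = g \<cdot> f"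
    using stable_exact_hom[OF ex f g] zero_comp[OF u Z] by simp
  moreover have "zero_arr C U Z \<in> Hom C (tgt C u) Z" "g \<in> Hom C (tgt C f) Z"
    using zero_hom[OF U Z] g st by simp_all
  ultimately have "\<exists>!v. v \<in> Hom C (tgt C f') Z \<and> v \<cdot> f' = zero_arr C U Z \<and> v \<cdot> u' = g"
    using po unfolding is_pushout_def by blast
  then obtain g' where g': "g' \<in> Hom C P Z" "g' \<cdot> f' = zero_arr C U Z" "g' \<cdot> u' = g"
    using st by auto
  have "pushout_complex C u f g f' g'"
    unfolding pushout_complex_def using po g' st by auto
  then have "short_exact C f' g'"
    using ex by (auto simp: stable_exact_def)
  moreover have "f' \<cdot> u = u' \<cdot> f" using po by (simp add: is_pushout_def)
  ultimately show ?thesis using that f' u' g' by blast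
qed

lemma stable_exact_pullback:
  assumes "stable_exact C f g" and "f \<in> Hom C X Y" and "g \<in> Hom C Y Z"
    and "u \<in> Hom C U Z"
  obtains P f' g' u' where "f' \<in> Hom C X P" "g' \<in> Hom C P U" "u' \<in> Hom C P Y"
    "u \<cdot> g' = g \<cdot> u'" "u' \<cdot> f' = f" "short_exact C f' g'"
  using preabelian_category.stable_exact_pushout
    [OF opposite_preabelian_category[OF preabelian_category_axioms], of g f Z Y X u U] assms
  by (metis Hom_opposite opposite_simps(6) short_exact_opposite stable_exact_opposite)

section \<open>Auslander-Reiten sequences\<close>

text \<open>For a non-section \<open>u\<close> with pushout sequence \<open>f'\<close>, \<open>g'\<close>, suppose that \<open>g'\<close> is not a retraction.
  Then \<open>g' = g h\<close>, and composing the sequence maps along \<open>u\<close> and back along \<open>h\<close> gives an endomorphism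
  of the original sequence that is the identity on \<open>Z\<close>. It therefore differs from the identity by a
  homotopy \<open>t\<close>, that is, it equals \<open>1 + f t\<close> on \<open>Y\<close> and \<open>1 + t f\<close> on \<open>X\<close>. The latter is invertible
  and factors through \<open>u\<close>, contradicting the choice of \<open>u\<close>.\<close>

lemma left_almost_split_of_right_almost_split:
  assumes ex: "stable_exact C f g" and f: "f \<in> Hom C X Y" and g: "g \<in> Hom C Y Z"
    and loc: "local_ring (end_ring C X)" and ras: "right_almost_split C g"
  shows "left_almost_split C f"
proof -
  note ex' = stable_exact_hom[OF ex f g]
  have X: "X \<in> obj C" and Y: "Y \<in> obj C" using f Hom_obj by auto
  have ng: "\<not> retraction_arr C g" using ras by (simp add: right_almost_split_def)
  then have nf: "\<not> section_arr C f"
    using cokernel_of_section_retraction[OF ex'(2) f g] by blast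
  have "\<exists>v \<in> Hom C Y U. u = v \<cdot> f" if u: "u \<in> Hom C X U" "\<not> section_arr C u" for u U
  proof -
    obtain P f' g' u' where f': "f' \<in> Hom C U P" and g': "g' \<in> Hom C P Z" and u': "u' \<in> Hom C Y P"
      and eq: "f' \<cdot> u = u' \<cdot> f" "g' \<cdot> u' = g" and se: "short_exact C f' g'"
      by (rule stable_exact_pushout[OF ex f g u(1)])
    have k': "is_kernel C f' g'" using se by (simp add: short_exact_def)
    then have gf': "g' \<cdot> f' = zero_arr C U Z"
      using f' g' by (auto simp: is_kernel_def Hom_def)
    have "retraction_arr C g'"
    proof (rule ccontr)
      assume "\<not> retraction_arr C g'"
      then obtain h where h: "h \<in> Hom C P Y" "g' = g \<cdot> h"
        using right_almost_splitD[OF ras g g'] by blast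
      have "g \<cdot> (h \<cdot> f') = zero_arr C U Z"
        using comp_assoc[OF f' h(1) g] h(2) gf' by metis
      then obtain w where w: "w \<in> Hom C U X" "h \<cdot> f' = f \<cdot> w"
        by (rule is_kernelE[OF ex'(1) f g comp_hom[OF f' h(1)]])
      \<comment> \<open>\<open>w\<close> is the map induced by \<open>h\<close> on the left ends, \<open>t\<close> the homotopy.\<close>
      define k where "k = h \<cdot> u' \<^bold>+ neg (ident C Y)"
      have hu: "h \<cdot> u' \<in> Hom C Y Y" using h u' comp_hom by blast
      have k: "k \<in> Hom C Y Y" unfolding k_def by (intro add_hom neg_hom ident_hom Y hu)
      have "g \<cdot> (h \<cdot> u') = g" using comp_assoc[OF u' h(1) g] h(2) eq(2) by metis
      then have "g \<cdot> k = zero_arr C Y Z"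
        using comp_add_right[OF hu neg_hom[OF ident_hom[OF Y]] g] comp_neg[OF ident_hom[OF Y] g]
          add_neg[OF g] comp_ident[OF g] by (simp add: k_def)
      then obtain t where t: "t \<in> Hom C Y X" "k = f \<cdot> t"
        using is_kernelE[OF ex'(1) f g k] by blast
      have tf: "t \<cdot> f \<in> Hom C X X" using t f comp_hom by blast
      have hu_eq: "h \<cdot> u' = ident C Y \<^bold>+ f \<cdot> t"
        using add_neg_cancel[OF hu ident_hom[OF Y]] t(2) by (simp add: k_def)
      have "f \<cdot> (w \<cdot> u) = (h \<cdot> f') \<cdot> u"
        using comp_assoc[OF u(1) w(1) f] w(2) by simp
      also have "\<dots> = (h \<cdot> u') \<cdot> f"
        using comp_assoc[OF u(1) f' h(1)] comp_assoc[OF f u' h(1)] eq(1) by simp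
      also have "\<dots> = f \<cdot> (ident C X \<^bold>+ t \<cdot> f)"
        unfolding hu_eq
        using comp_add_left[OF f ident_hom[OF Y] comp_hom[OF t(1) f]]
          comp_add_right[OF ident_hom[OF X] tf f] comp_assoc[OF f t(1) f] ident_comp[OF f]
          comp_ident[OF f] by simp
      finally have *: "f \<cdot> (w \<cdot> u) = f \<cdot> (ident C X \<^bold>+ t \<cdot> f)" .
      have "w \<cdot> u = ident C X \<^bold>+ t \<cdot> f"
        using is_kernel_mono[OF ex'(1) f _ _ *] comp_hom[OF u(1) w(1)]
          add_hom[OF ident_hom[OF X] tf] by blast
      then have "section_arr C (w \<cdot> u)"
        using one_plus_iso_of_local[OF f nf t(1) loc] iso_arr_section by simp
      then show False using section_arr_of_comp[OF u(1) w(1)] u(2) by blast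
    qed
    then have "section_arr C f'"
      using section_of_retraction_kernel[OF k' f' g'] by blast
    then obtain r where r: "r \<in> Hom C P U" "r \<cdot> f' = ident C U"
      using section_arr_iff[OF f'] by blast
    have "u = (r \<cdot> f') \<cdot> u" using r(2) ident_comp[OF u(1)] by simp
    also have "\<dots> = (r \<cdot> u') \<cdot> f"
      using comp_assoc[OF u(1) f' r(1)] comp_assoc[OF f u' r(1)] eq(1) by simp
    finally show ?thesis using comp_hom[OF u' r(1)] by blast
  qed
  then show ?thesis
    using f nf unfolding left_almost_split_def by (auto simp: Hom_def)
qed

lemma right_almost_split_local_ring_end:
  assumes "right_almost_split C g" "g \<in> Hom C Y Z"
  shows "local_ring (end_ring C Z)"
  using preadditive_category.left_almost_split_local_ring_end
    [OF opposite_preadditive_category[OF preadditive_category_axioms], of g Z Y] assms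
    local_ring_end_opposite[of Z] Hom_obj by simp

lemma left_minimal_of_cokernel:
  assumes "is_cokernel C g f" "f \<in> Hom C X Y" "g \<in> Hom C Y Z" "\<not> retraction_arr C g"
    "local_ring (end_ring C Z)"
  shows "left_minimal C f"
  using preadditive_category.right_minimal_of_kernel
    [OF opposite_preadditive_category[OF preadditive_category_axioms], of g f Z Y X] assms
    local_ring_end_opposite[of Z] Hom_obj by simp

lemma auslander_reiten_iff_right_almost_split:
  assumes ex: "stable_exact C f g" and f: "f \<in> Hom C X Y" and g: "g \<in> Hom C Y Z"
  shows "auslander_reiten_sequence C f g \<longleftrightarrow>
    local_ring (end_ring C X) \<and> right_almost_split C g"
proof
  assume "auslander_reiten_sequence C f g"
  then show "local_ring (end_ring C X) \<and> right_almost_split C g"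
    using left_almost_split_local_ring_end f
    by (auto simp: auslander_reiten_sequence_def minimal_left_almost_split_def
        minimal_right_almost_split_def)
next
  assume *: "local_ring (end_ring C X) \<and> right_almost_split C g"
  note ex' = stable_exact_hom[OF ex f g]
  have las: "left_almost_split C f"
    using left_almost_split_of_right_almost_split[OF ex f g] * by blast
  have nf: "\<not> section_arr C f" using las by (simp add: left_almost_split_def)
  have ng: "\<not> retraction_arr C g" using * by (simp add: right_almost_split_def)
  have "right_minimal C g" using right_minimal_of_kernel[OF ex'(1) f nf g] * by blast
  moreover have "left_minimal C f"
    using left_minimal_of_cokernel[OF ex'(2) f g ng] right_almost_split_local_ring_end[OF _ g] *
    by blast
  moreover have "weak_kernel C f g" "weak_cokernel C g f"
    using ex' unfolding weak_kernel_def weak_cokernel_def is_kernel_def is_cokernel_def by blast+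
  ultimately show "auslander_reiten_sequence C f g"
    using las * by (simp add: auslander_reiten_sequence_def minimal_left_almost_split_def
        minimal_right_almost_split_def)
qed

lemma auslander_reiten_iff_left_almost_split:
  assumes "stable_exact C f g" and "f \<in> Hom C X Y" and "g \<in> Hom C Y Z"
  shows "auslander_reiten_sequence C f g \<longleftrightarrow>
    local_ring (end_ring C Z) \<and> left_almost_split C f"
  using preabelian_category.auslander_reiten_iff_right_almost_split
    [OF opposite_preabelian_category[OF preabelian_category_axioms], of g f Z Y X] assms
    local_ring_end_opposite[of Z] Hom_obj by simp

section \<open>Irreducible morphisms\<close>

text \<open>Pulling back along \<open>u\<close> factors \<open>f\<close> as \<open>u' f'\<close>. If \<open>u'\<close> is a retraction, \<open>g\<close> factors through
  \<open>u\<close>; if \<open>f'\<close> is a section, the pullback sequence splits and \<open>u\<close> factors through \<open>g\<close>.\<close>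

lemma irreducible_dichotomy:
  assumes ex: "stable_exact C f g" and f: "f \<in> Hom C X Y" and g: "g \<in> Hom C Y Z"
    and irr: "irreducible_arr C f" and u: "u \<in> Hom C U Z"
  shows "(\<exists>v \<in> Hom C U Y. u = g \<cdot> v) \<or> (\<exists>q \<in> Hom C Y U. g = u \<cdot> q)"
proof -
  obtain P f' g' u' where f': "f' \<in> Hom C X P" and g': "g' \<in> Hom C P U" and u': "u' \<in> Hom C P Y"
    and eq: "u \<cdot> g' = g \<cdot> u'" "u' \<cdot> f' = f" and se: "short_exact C f' g'"
    by (rule stable_exact_pullback[OF ex f g u])
  have "retraction_arr C u' \<or> section_arr C f'"
    using irreducible_arrD[OF irr eq(2)[symmetric] f f' u'] .
  then show ?thesis
  proof
    assume "retraction_arr C u'"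
    then obtain s where s: "s \<in> Hom C Y P" "u' \<cdot> s = ident C Y"
      using retraction_arr_iff[OF u'] by blast
    have "u \<cdot> (g' \<cdot> s) = g \<cdot> (u' \<cdot> s)"
      using comp_assoc[OF s(1) g' u] comp_assoc[OF s(1) u' g] eq(1) by simp
    then have "g = u \<cdot> (g' \<cdot> s)" using s(2) comp_ident[OF g] by simp
    then show ?thesis using comp_hom[OF s(1) g'] by blast
  next
    assume "section_arr C f'"
    then have "retraction_arr C g'"
      using cokernel_of_section_retraction[OF _ f' g'] se by (simp add: short_exact_def)
    then obtain s where s: "s \<in> Hom C U P" "g' \<cdot> s = ident C U"
      using retraction_arr_iff[OF g'] by blast
    have "u \<cdot> (g' \<cdot> s) = g \<cdot> (u' \<cdot> s)"
      using comp_assoc[OF s(1) g' u] comp_assoc[OF s(1) u' g] eq(1) by simp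
    then have "u = g \<cdot> (u' \<cdot> s)" using s(2) comp_ident[OF u] by simp
    then show ?thesis using comp_hom[OF s(1) u'] by blast
  qed
qed

end

section \<open>Krull-Schmidt categories\<close>

locale krull_schmidt_preabelian_category = preabelian_category + krull_schmidt_category

lemma opposite_krull_schmidt_preabelian_category:
  assumes "krull_schmidt_preabelian_category C"
  shows "krull_schmidt_preabelian_category (opposite C)"
proof -
  interpret krull_schmidt_preabelian_category C by (fact assms)
  interpret op: preabelian_category "opposite C"
    by (rule opposite_preabelian_category) (rule preabelian_category_axioms)
  show ?thesis
  proof
    fix X assume "X \<in> obj (opposite C)"
    then have X: "X \<in> obj C" by simp
    obtain n A i p where *: "\<forall>k<n. A k \<in> obj C \<and> local_ring (end_ring C (A k))"
      "is_direct_sum C n A X i p"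
      using local_decomposition[OF X] by blast
    then have "\<forall>k<n. A k \<in> obj (opposite C) \<and> local_ring (end_ring (opposite C) (A k))"
      using local_ring_end_opposite by simp
    moreover have "is_direct_sum (opposite C) n A X p i" using *(2) by simp
    ultimately show "\<exists>n A i p. (\<forall>k<n. A k \<in> obj (opposite C) \<and>
        local_ring (end_ring (opposite C) (A k))) \<and> is_direct_sum (opposite C) n A X i p"
      by blast
  qed
qed

context preadditive_category
begin

lemma factors_through_if_summands_factor:
  assumes S: "is_direct_sum C n A S i p" and u: "u \<in> Hom C S Z" and g: "g \<in> Hom C Y Z"
    and fact: "\<And>k. k < n \<Longrightarrow> \<exists>v \<in> Hom C (A k) Y. u \<cdot> i k = g \<cdot> v"
  shows "\<exists>v \<in> Hom C S Y. u = g \<cdot> v"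
proof -
  have S': "S \<in> obj C" and Y: "Y \<in> obj C" using u g Hom_obj by auto
  have "\<exists>v \<in> Hom C S Y. u \<cdot> ident C S = g \<cdot> v"
  proof (rule direct_sum_induct[OF S, where P = "\<lambda>a. \<exists>v \<in> Hom C S Y. u \<cdot> a = g \<cdot> v"])
    show "\<exists>v \<in> Hom C S Y. u \<cdot> zero_arr C S S = g \<cdot> v"
      using comp_zero[OF u S'] comp_zero[OF g S'] zero_hom[OF S' Y] by metis
    show "\<exists>v \<in> Hom C S Y. u \<cdot> (a \<^bold>+ b) = g \<cdot> v"
      if ab: "a \<in> Hom C S S" "b \<in> Hom C S S" "\<exists>v \<in> Hom C S Y. u \<cdot> a = g \<cdot> v"
        "\<exists>v \<in> Hom C S Y. u \<cdot> b = g \<cdot> v" for a b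
    proof -
      obtain v w where v: "v \<in> Hom C S Y" "u \<cdot> a = g \<cdot> v" and w: "w \<in> Hom C S Y" "u \<cdot> b = g \<cdot> w"
        using ab(3,4) by blast
      have "u \<cdot> (a \<^bold>+ b) = g \<cdot> (v \<^bold>+ w)"
        using comp_add_right[OF ab(1,2) u] comp_add_right[OF v(1) w(1) g] v(2) w(2) by simp
      then show ?thesis using add_hom[OF v(1) w(1)] by blast
    qed
    fix k assume k: "k < n"
    then have ip: "i k \<in> Hom C (A k) S" "p k \<in> Hom C S (A k)"
      using S by (auto simp: is_direct_sum_def)
    obtain v where v: "v \<in> Hom C (A k) Y" "u \<cdot> i k = g \<cdot> v" using fact[OF k] by blast
    have "u \<cdot> (i k \<cdot> p k) = g \<cdot> (v \<cdot> p k)"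
      using comp_assoc[OF ip(2,1) u] comp_assoc[OF ip(2) v(1) g] v(2) by simp
    then show "\<exists>v \<in> Hom C S Y. u \<cdot> (i k \<cdot> p k) = g \<cdot> v"
      using comp_hom[OF ip(2) v(1)] by blast
  qed
  then show ?thesis using comp_ident[OF u] by simp
qed

end

context krull_schmidt_preabelian_category
begin

text \<open>Some inclusion \<open>i k\<close> of a local summand of \<open>Z\<close> does not factor through \<open>g\<close>, as \<open>g\<close> is not a
  retraction. By the dichotomy \<open>g = i k \<cdot> q\<close>, so \<open>i k \<cdot> p k\<close> fixes \<open>g\<close> and, \<open>g\<close> being epi, equals
  the identity of \<open>Z\<close>: the summand is isomorphic to \<open>Z\<close>.\<close>

lemma irreducible_kernel_local_ring_end:
  assumes ex: "stable_exact C f g" and f: "f \<in> Hom C X Y" and g: "g \<in> Hom C Y Z"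
    and irr: "irreducible_arr C f"
  shows "local_ring (end_ring C Z)"
proof -
  note ex' = stable_exact_hom[OF ex f g]
  have Z: "Z \<in> obj C" using g Hom_obj by blast
  have "\<not> section_arr C f" using irr by (simp add: irreducible_arr_def)
  then have ng: "\<not> retraction_arr C g"
    using section_of_retraction_kernel[OF ex'(1) f g] by blast
  obtain n A i p where loc: "\<forall>k<n. A k \<in> obj C \<and> local_ring (end_ring C (A k))"
    and ds: "is_direct_sum C n A Z i p"
    using local_decomposition[OF Z] by blast
  have "\<exists>k<n. \<not> (\<exists>v \<in> Hom C (A k) Y. i k = g \<cdot> v)"
  proof (rule ccontr)
    assume "\<not> ?thesis"
    then have "\<exists>v \<in> Hom C (A k) Y. ident C Z \<cdot> i k = g \<cdot> v" if "k < n" for k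
      using that ds ident_comp unfolding is_direct_sum_def by metis
    then have "\<exists>v \<in> Hom C Z Y. ident C Z = g \<cdot> v"
      using factors_through_if_summands_factor[OF ds ident_hom[OF Z] g] by blast
    then show False using ng retraction_arr_iff[OF g] by metis
  qed
  then obtain k where k: "k < n" and nv: "\<not> (\<exists>v \<in> Hom C (A k) Y. i k = g \<cdot> v)" by blast
  have i: "i k \<in> Hom C (A k) Z" and p: "p k \<in> Hom C Z (A k)" and pi: "p k \<cdot> i k = ident C (A k)"
    using ds k by (auto simp: is_direct_sum_def)
  obtain q where q: "q \<in> Hom C Y (A k)" "g = i k \<cdot> q"
    using irreducible_dichotomy[OF ex f g irr i] nv by blast
  have "(i k \<cdot> p k) \<cdot> g = i k \<cdot> ((p k \<cdot> i k) \<cdot> q)"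
    using comp_assoc[OF g p i] comp_assoc[OF q(1) i p] q(2) by metis
  also have "\<dots> = ident C Z \<cdot> g"
    using pi ident_comp[OF q(1)] q(2) ident_comp[OF g] by metis
  finally have "i k \<cdot> p k = ident C Z"
    using is_cokernel_epi[OF ex'(2) g] comp_hom[OF p i] ident_hom[OF Z] by blast
  then show ?thesis using local_ring_end_iso[OF i p pi] loc k by blast
qed

text \<open>A mono retraction is invertible, so \<open>f\<close> is not a retraction and is therefore irreducible; this
  makes \<open>End Z\<close> local.\<close>

lemma minimal_left_almost_split_imp_auslander_reiten:
  assumes ex: "stable_exact C f g" and f: "f \<in> Hom C X Y" and g: "g \<in> Hom C Y Z"
    and min: "minimal_left_almost_split C f"
  shows "irreducible_arr C f" "auslander_reiten_sequence C f g"
proof -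
  note ex' = stable_exact_hom[OF ex f g]
  have las: "left_almost_split C f" using min by (simp add: minimal_left_almost_split_def)
  have "\<not> retraction_arr C f"
  proof
    assume "retraction_arr C f"
    then obtain s where s: "s \<in> Hom C Y X" "f \<cdot> s = ident C Y"
      using retraction_arr_iff[OF f] by blast
    have X: "X \<in> obj C" using f Hom_obj by blast
    have "f \<cdot> (s \<cdot> f) = f \<cdot> ident C X"
      using comp_assoc[OF f s(1) f] s(2) ident_comp[OF f] comp_ident[OF f] by simp
    then have "s \<cdot> f = ident C X"
      using is_kernel_mono[OF ex'(1) f] comp_hom[OF f s(1)] ident_hom[OF X] by blast
    then show False
      using section_arr_iff[OF f] s(1) las by (auto simp: left_almost_split_def)
  qed
  then show irr: "irreducible_arr C f"
    using minimal_left_almost_split_irreducible[OF min] by blast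
  show "auslander_reiten_sequence C f g"
    using auslander_reiten_iff_left_almost_split[OF ex f g] las
      irreducible_kernel_local_ring_end[OF ex f g irr] by blast
qed

text \<open>It suffices to lift non-retractions \<open>u\<close> that start in an object \<open>U\<close> with local endomorphism ring.
  If \<open>u\<close> does not factor through \<open>g\<close>, then \<open>g = u q\<close> by the dichotomy, and \<open>q\<close> is a section since
  \<open>g\<close> is irreducible and \<open>u\<close> is not a retraction. A nonzero summand of \<open>U\<close> is all of \<open>U\<close>, so \<open>q\<close> is
  invertible and \<open>u = g q\<^sup>-\<^sup>1\<close> after all.\<close>

lemma irreducible_imp_right_almost_split:
  assumes ex: "stable_exact C f g" and f: "f \<in> Hom C X Y" and g: "g \<in> Hom C Y Z"
    and irrf: "irreducible_arr C f" and irrg: "irreducible_arr C g"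
  shows "right_almost_split C g"
proof -
  have Y: "Y \<in> obj C" and Z: "Z \<in> obj C" using g Hom_obj by auto
  have ng: "\<not> retraction_arr C g" using irrg by (simp add: irreducible_arr_def)
  have nz: "ident C Y \<noteq> zero_arr C Y Y"
  proof
    assume "ident C Y = zero_arr C Y Y"
    then have "zero_arr C Z Y \<cdot> g = ident C Y" using zero_comp[OF g Y] by simp
    then have "section_arr C g" using section_arr_iff[OF g] zero_hom[OF Z Y] by blast
    then show False using irrg by (simp add: irreducible_arr_def)
  qed
  have indec: "\<exists>v \<in> Hom C U Y. u = g \<cdot> v"
    if u: "u \<in> Hom C U Z" "\<not> retraction_arr C u" and loc: "local_ring (end_ring C U)" for u U
  proof (rule ccontr)
    assume no: "\<not> ?thesis"
    have U: "U \<in> obj C" using u Hom_obj by blast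
    obtain q where q: "q \<in> Hom C Y U" "g = u \<cdot> q"
      using irreducible_dichotomy[OF ex f g irrf u(1)] no by blast
    have "section_arr C q"
      using irreducible_arrD[OF irrg q(2) g q(1) u(1)] u(2) by blast
    then obtain r where r: "r \<in> Hom C U Y" "r \<cdot> q = ident C Y"
      using section_arr_iff[OF q(1)] by blast
    show False
    proof (cases "section_arr C r")
      case True
      then obtain s where s: "s \<in> Hom C Y U" "s \<cdot> r = ident C U"
        using section_arr_iff[OF r(1)] by blast
      have "s = (s \<cdot> r) \<cdot> q"
        using comp_assoc[OF q(1) r(1) s(1)] r(2) comp_ident[OF s(1)] by simp
      then have "s = q" using s(2) ident_comp[OF q(1)] by simp
      then have "g \<cdot> r = u"
        using comp_assoc[OF r(1) q(1) u(1)] q(2) s(2) comp_ident[OF u(1)] by metis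
      then show False using no r(1) by blast
    next
      case False
      \<comment> \<open>\<open>m = 1 - q r\<close> is invertible and annihilates \<open>q\<close>.\<close>
      define m where "m = ident C U \<^bold>+ neg q \<cdot> r"
      have nqr: "neg q \<cdot> r \<in> Hom C U U" using comp_hom[OF r(1) neg_hom[OF q(1)]] .
      have m: "m \<in> Hom C U U" unfolding m_def by (intro add_hom ident_hom U nqr)
      have "iso_arr C m"
        using one_plus_iso_of_local[OF r(1) False neg_hom[OF q(1)] loc] by (simp add: m_def)
      then obtain w where w: "w \<in> Hom C U U" "w \<cdot> m = ident C U"
        using iso_arr_iff[OF m] by blast
      have "m \<cdot> q = zero_arr C Y U"
        using comp_add_left[OF q(1) ident_hom[OF U] nqr] comp_assoc[OF q(1) r(1) neg_hom[OF q(1)]]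
          r(2) comp_ident[OF neg_hom[OF q(1)]] ident_comp[OF q(1)] add_neg[OF q(1)]
        by (simp add: m_def)
      then have "q = zero_arr C Y U"
        using comp_assoc[OF q(1) m w(1)] w(2) ident_comp[OF q(1)] comp_zero[OF w(1) Y] by simp
      then show False using r comp_zero[OF r(1) Y] nz by simp
    qed
  qed
  have "\<exists>v \<in> Hom C U Y. u = g \<cdot> v" if u: "u \<in> Hom C U Z" "\<not> retraction_arr C u" for u U
  proof -
    have U: "U \<in> obj C" using u Hom_obj by blast
    obtain n A i p where loc: "\<forall>k<n. A k \<in> obj C \<and> local_ring (end_ring C (A k))"
      and ds: "is_direct_sum C n A U i p"
      using local_decomposition[OF U] by blast
    show ?thesis
    proof (rule factors_through_if_summands_factor[OF ds u(1) g])
      fix k assume k: "k < n"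
      have i: "i k \<in> Hom C (A k) U" using ds k by (auto simp: is_direct_sum_def)
      have "\<not> retraction_arr C (u \<cdot> i k)"
        using retraction_of_comp[OF i u(1)] u(2) by blast
      then show "\<exists>v \<in> Hom C (A k) Y. u \<cdot> i k = g \<cdot> v"
        using indec[OF comp_hom[OF i u(1)]] loc k by blast
    qed
  qed
  then show ?thesis
    using g ng unfolding right_almost_split_def by (auto simp: Hom_def)
qed

lemma minimal_right_almost_split_imp_auslander_reiten:
  assumes "stable_exact C f g" and "f \<in> Hom C X Y" and "g \<in> Hom C Y Z"
    and "minimal_right_almost_split C g"
  shows "irreducible_arr C g" "auslander_reiten_sequence C f g"
  using krull_schmidt_preabelian_category.minimal_left_almost_split_imp_auslander_reiten
    [OF opposite_krull_schmidt_preabelian_category[OF krull_schmidt_preabelian_category_axioms],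
      of g f Z Y X] assms by simp_all

lemma irreducible_cokernel_local_ring_end:
  assumes "stable_exact C f g" and "f \<in> Hom C X Y" and "g \<in> Hom C Y Z"
    and "irreducible_arr C g"
  shows "local_ring (end_ring C X)"
  using krull_schmidt_preabelian_category.irreducible_kernel_local_ring_end
    [OF opposite_krull_schmidt_preabelian_category[OF krull_schmidt_preabelian_category_axioms],
      of g f Z Y X] assms local_ring_end_opposite[of X] Hom_obj by simp

lemma auslander_reiten_iff_irreducible:
  assumes ex: "stable_exact C f g" and f: "f \<in> Hom C X Y" and g: "g \<in> Hom C Y Z"
  shows "auslander_reiten_sequence C f g \<longleftrightarrow> irreducible_arr C f \<and> irreducible_arr C g"
proof
  assume "auslander_reiten_sequence C f g"
  then show "irreducible_arr C f \<and> irreducible_arr C g"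
    using minimal_left_almost_split_imp_auslander_reiten(1)[OF ex f g]
      minimal_right_almost_split_imp_auslander_reiten(1)[OF ex f g]
    by (simp add: auslander_reiten_sequence_def)
next
  assume *: "irreducible_arr C f \<and> irreducible_arr C g"
  then show "auslander_reiten_sequence C f g"
    using auslander_reiten_iff_right_almost_split[OF ex f g]
      irreducible_cokernel_local_ring_end[OF ex f g] irreducible_imp_right_almost_split[OF ex f g]
    by blast
qed

end

theorem theorem4p19:
  fixes C :: "('o, 'm, 'z) preadditive_category_scheme"
  assumes "skeletally_small C"
    and "preabelian_category C"
    and "f \<in> Hom C X Y"
    and "g \<in> Hom C Y Z"
    and "stable_exact C f g"
  shows "(auslander_reiten_sequence C f g \<longleftrightarrow>
            local_ring (end_ring C X) \<and> right_almost_split C g)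
       \<and> (auslander_reiten_sequence C f g \<longleftrightarrow>
            local_ring (end_ring C Z) \<and> left_almost_split C f)
       \<and> (quasi_abelian_category C \<and> krull_schmidt_category C \<longrightarrow>
            (auslander_reiten_sequence C f g \<longleftrightarrow> minimal_left_almost_split C f)
          \<and> (auslander_reiten_sequence C f g \<longleftrightarrow> minimal_right_almost_split C g)
          \<and> (auslander_reiten_sequence C f g \<longleftrightarrow> irreducible_arr C f \<and> irreducible_arr C g))"
proof (intro conjI impI)
  interpret preabelian_category C by (fact assms(2))
  show "auslander_reiten_sequence C f g \<longleftrightarrow>
      local_ring (end_ring C X) \<and> right_almost_split C g"
    using auslander_reiten_iff_right_almost_split[OF assms(5,3,4)] .
  show "auslander_reiten_sequence C f g \<longleftrightarrow>
      local_ring (end_ring C Z) \<and> left_almost_split C f"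
    using auslander_reiten_iff_left_almost_split[OF assms(5,3,4)] .
next
  assume "quasi_abelian_category C \<and> krull_schmidt_category C"
  then interpret krull_schmidt_preabelian_category C
    using assms(2) by (simp add: krull_schmidt_preabelian_category_def)
  show "auslander_reiten_sequence C f g \<longleftrightarrow> minimal_left_almost_split C f"
    using minimal_left_almost_split_imp_auslander_reiten(2)[OF assms(5,3,4)]
    by (auto simp: auslander_reiten_sequence_def)
  show "auslander_reiten_sequence C f g \<longleftrightarrow> minimal_right_almost_split C g"
    using minimal_right_almost_split_imp_auslander_reiten(2)[OF assms(5,3,4)]
    by (auto simp: auslander_reiten_sequence_def)
  show "auslander_reiten_sequence C f g \<longleftrightarrow> irreducible_arr C f \<and> irreducible_arr C g"
    using auslander_reiten_iff_irreducible[OF assms(5,3,4)] .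
qed

end
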